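(* Let $d\ge 1$, $a,w_1,\dots,w_d\in\mathcal H$, $\bm w=(w_1,\dots,w_d)$, and let $q\in\{1,\dots,d\}$. Then the finite part at $\alpha=q$ of the Barnes zeta function is $$\begin{aligned} F.P.[\zeta_{\rm B}(\alpha,a|\bm w)]_{\alpha=q}={}&\frac{(-1)^{d-q+1}}{(q-1)!}\sum_{m=0}^{d-q}\frac{{}_dS_m^{(d)}(0)\,a^{d-q-m}}{m!\,(d-q-m)!}\bigl(\log a-H_{d-q-m}+H_{q-1}\bigr)\\ &+\sum_{\bm n\in\mathbb N_0^d}\Biggl[\frac{1}{(a+\bm n\cdot\bm w)^q}+\frac{(-1)^q}{(q-1)!}\sum_{m=0}^{d-q}\frac{{}_dS_m^{(d)}(0)}{m!\,(d-q-m)!}\\ &\qquad\times G\bigl[(a+\bm n\cdot\bm w+x)^{d-q-m}\log(a+\bm n\cdot\bm w+x)\bigr]_{x=\bm w}\Biggr]. \end{aligned}$$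
   Context: $\mathcal H=\{z\in\mathbb C:\theta-\frac{\pi}{2}<\arg z<\theta+\frac{\pi}{2}\}$ is a fixed open half-plane ($\theta$ a fixed real angle), and $\log$ is a fixed holomorphic branch of the logarithm on $\mathcal H$; $z^s=\exp(s\log z)$ for $z\in\mathcal H$. $\mathbb N_0=\{0,1,2,\dots\}$ and $\bm n\cdot\bm w=\sum_{i=1}^d n_iw_i$. The Barnes zeta function is $\zeta_{\rm B}(\alpha,a|\bm w)=\sum_{\bm n\in\mathbb N_0^d}(a+\bm n\cdot\bm w)^{-\alpha}$ for $\Re(\alpha)>d$; it extends meromorphically in $\alpha$ to $\mathbb C$, with at most simple poles, located at $\alpha=1,\dots,d$. $F.P.[f(\alpha)]_{\alpha=q}$ denotes the constant term of the Laurent expansion of $f$ at $\alpha=q$. For $\bm v\in\mathbb C^d$ and a function $g$ of $x$, $G[g(x)]_{x=\bm v}=\sum_{S\subseteq\{1,\dots,d\}}(-1)^{d-|S|}g\bigl(\sum_{i\in S}v_i\bigr)$ (the empty set contributes $(-1)^dg(0)$). Harmonic numbers: $H_k=\sum_{i=1}^k 1/i$, $H_0=0$. The higher order Bernoulli polynomials $B_n(a|\bm w)$ are defined by $z^d{\rm e}^{az}\prod_{i=1}^d\frac{w_i}{{\rm e}^{w_iz}-1}=\sum_{n\ge0}B_n(a|\bm w)\frac{z^n}{n!}$ for $|z|<2\pi/\max_i|w_i|$. The Bernoullian functions ${}_dS_n(a)$ ($n\ge0$; dependence on $\bm w$ suppressed) are the polynomials in $a$ with ${}_dS_n(0)=0$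 and ${}_dS_n'(a)=\frac{n!}{(n+d-1)!\,\prod_{i=1}^dw_i}B_{n+d-1}(a|\bm w)$; ${}_dS_m^{(d)}(0)$ is the $d$-th derivative in $a$ at $a=0$ (equivalently ${}_dS_m^{(d)}(0)=B_m(0|\bm w)/\prod_{i=1}^dw_i$). The sum over $\mathbb N_0^d$ is understood as an unordered (absolutely convergent) sum of the bracketed terms. *)

theory Defs
  imports "HOL-Complex_Analysis.Complex_Analysis"
begin

definition half_plane :: "real \<Rightarrow> complex set" where
  "half_plane \<theta> =
     {complex_of_real r * cis t | r t. r > 0 \<and> \<theta> - pi / 2 < t \<and> t < \<theta> + pi / 2}"

definition log_branch_on :: "complex set \<Rightarrow> (complex \<Rightarrow> complex) \<Rightarrow> bool" where
  "log_branch_on H L \<longleftrightarrow> L holomorphic_on H \<and> (\<forall>z\<in>H. exp (L z) = z)"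

text \<open>The vectors of \<open>\<nat>\<^sub>0\<^sup>d\<close> are the functions on \<open>{1..d}\<close>, taken to be
  \<^const>\<open>undefined\<close> outside so that each vector is counted once.\<close>

definition nat_vecs :: "nat \<Rightarrow> (nat \<Rightarrow> nat) set" where
  "nat_vecs d = {1..d} \<rightarrow>\<^sub>E UNIV"

definition ndot :: "nat \<Rightarrow> (nat \<Rightarrow> nat) \<Rightarrow> (nat \<Rightarrow> complex) \<Rightarrow> complex" where
  "ndot d n w = (\<Sum>i=1..d. of_nat (n i) * w i)"

definition barnes_series ::
    "(complex \<Rightarrow> complex) \<Rightarrow> nat \<Rightarrow> complex \<Rightarrow> (nat \<Rightarrow> complex) \<Rightarrow> complex \<Rightarrow> complex" where
  "barnes_series L d a w \<alpha> = (\<Sum>\<^sub>\<infinity>n\<in>nat_vecs d. exp (- \<alpha> * L (a + ndot d n w)))"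

text \<open>The meromorphic continuation to the whole plane. Niceness only normalises the value at
  each singularity (0 at a pole, the limit at a removable one), which makes the continuation
  unique as a function; Laurent expansions do not depend on it.\<close>

definition barnes_zeta ::
    "(complex \<Rightarrow> complex) \<Rightarrow> nat \<Rightarrow> complex \<Rightarrow> (nat \<Rightarrow> complex) \<Rightarrow> complex \<Rightarrow> complex" where
  "barnes_zeta L d a w =
     (THE Z. Z nicely_meromorphic_on UNIV \<and>
             (\<forall>\<alpha>. Re \<alpha> > real d \<longrightarrow> Z \<alpha> = barnes_series L d a w \<alpha>))"

definition finite_part :: "(complex \<Rightarrow> complex) \<Rightarrow> complex \<Rightarrow> complex" where
  "finite_part f q = fls_nth (laurent_expansion f q) 0"

definition G_op :: "nat \<Rightarrow> (complex \<Rightarrow> complex) \<Rightarrow> (nat \<Rightarrow> complex) \<Rightarrow> complex" where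
  "G_op d g v = (\<Sum>S\<in>Pow {1..d}. (-1) ^ (d - card S) * g (\<Sum>i\<in>S. v i))"

text \<open>The generating function \<open>z\<^sup>d e\<^sup>a\<^sup>z \<Prod>\<^sub>i w\<^sub>i / (e\<^bsup>w\<^sub>i z\<^esup> - 1)\<close> is read as a formal power
  series in \<open>z\<close>; lemma \<open>higher_bernoulli_sums\<close> gives the analytic identity.\<close>

definition higher_bernoulli :: "nat \<Rightarrow> (nat \<Rightarrow> complex) \<Rightarrow> nat \<Rightarrow> complex \<Rightarrow> complex" where
  "higher_bernoulli d w n a =
     fact n * fps_nth (fps_exp a * (\<Prod>i=1..d. fps_const (w i) * fps_X / (fps_exp (w i) - 1))) n"

definition bernoullian :: "nat \<Rightarrow> (nat \<Rightarrow> complex) \<Rightarrow> nat \<Rightarrow> complex poly" where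
  "bernoullian d w n =
     (THE p. poly p 0 = 0 \<and>
        (\<forall>a. poly (pderiv p) a =
              fact n / (fact (n + d - 1) * (\<Prod>i=1..d. w i)) * higher_bernoulli d w (n + d - 1) a))"

lemma higher_bernoulli_sums:
  assumes w: "\<And>i. i \<in> {1..d} \<Longrightarrow> w i \<noteq> 0"
    and z: "z \<noteq> 0" "\<And>i. i \<in> {1..d} \<Longrightarrow> norm (w i) * norm z < 2 * pi"
  shows "(\<lambda>n. higher_bernoulli d w n a * z ^ n / fact n) sums
           (z ^ d * exp (a * z) * (\<Prod>i=1..d. w i / (exp (w i * z) - 1)))"
proof -
  define h where "h = (\<lambda>i u. if u = 0 then 1 else w i * u / (exp (w i * u) - 1))"
  define F where "F = (\<lambda>u. exp (a * u) * (\<Prod>i=1..d. h i u))"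
  have hexp: "h i has_fps_expansion fps_const (w i) * fps_X / (fps_exp (w i) - 1)"
    if "i \<in> {1..d}" for i
  proof -
    define N where "N = fps_const (w i) * fps_X"
    define D where "D = fps_exp (w i) - 1"
    have wi: "w i \<noteq> 0" using w[OF that] .
    have sd: "subdegree D = 1" "subdegree N = 1"
      using wi by (auto intro!: subdegreeI simp: D_def N_def)
    have "D \<noteq> 0" using sd by auto
    have "(\<lambda>u. w i * u) has_fps_expansion N"
      unfolding N_def by (intro fps_expansion_intros)
    moreover have "(\<lambda>u. exp (w i * u) - 1) has_fps_expansion D"
      unfolding D_def by (intro fps_expansion_intros)
    moreover have "1 = fps_nth N (subdegree D) / fps_nth D (subdegree D)"
      unfolding sd using wi by (simp add: N_def D_def)
    ultimately have "(\<lambda>u. if u = 0 then 1 else w i * u / (exp (w i * u) - 1))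
                       has_fps_expansion N / D"
      using \<open>D \<noteq> 0\<close> by (intro has_fps_expansion_divide) (simp_all only: sd order.refl not_False_eq_True)
    thus ?thesis unfolding h_def N_def D_def .
  qed
  have Fexp: "F has_fps_expansion
      fps_exp a * (\<Prod>i=1..d. fps_const (w i) * fps_X / (fps_exp (w i) - 1))"
    unfolding F_def by (intro has_fps_expansion_mult has_fps_expansion_exp
        has_fps_expansion_prod hexp) auto
  obtain R where R: "norm z < R" "\<And>i. i \<in> {1..d} \<Longrightarrow> norm (w i) * R \<le> 2 * pi"
  proof (cases "d = 0")
    case True
    thus ?thesis using that[of "norm z + 1"] by auto
  next
    case False
    define R where "R = Min ((\<lambda>i. 2 * pi / norm (w i)) ` {1..d})"
    have "norm z < R"
      unfolding R_def using False w z(2)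
      by (subst Min_gr_iff) (auto simp: field_simps)
    moreover have "norm (w i) * R \<le> 2 * pi" if "i \<in> {1..d}" for i
    proof -
      have "R \<le> 2 * pi / norm (w i)"
        unfolding R_def using that by (intro Min_le) auto
      thus ?thesis using w[OF that] by (simp add: field_simps)
    qed
    ultimately show ?thesis using that by blast
  qed
  have hol: "h i holomorphic_on ball 0 R" if i: "i \<in> {1..d}" for i
  proof -
    have nz: "exp (w i * u) - 1 \<noteq> 0" if u: "u \<in> ball 0 R - {0}" for u
    proof
      assume "exp (w i * u) - 1 = 0"
      then obtain k :: int where k: "Re (w i * u) = 0" "Im (w i * u) = real_of_int (2 * k) * pi"
        by (auto simp: exp_eq_1)
      have "norm (w i * u) < 2 * pi"
      proof -
        have "norm (w i) * norm u < norm (w i) * R"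
          using u w[OF i] by (intro mult_strict_left_mono) auto
        thus ?thesis using R(2)[OF i] by (simp add: norm_mult)
      qed
      moreover have "\<bar>real_of_int (2 * k) * pi\<bar> \<le> norm (w i * u)"
        unfolding k(2)[symmetric] by (rule abs_Im_le_cmod)
      moreover have "\<bar>real_of_int (2 * k) * pi\<bar> = \<bar>real_of_int (2 * k)\<bar> * pi"
        unfolding abs_mult by simp
      ultimately have "\<bar>real_of_int (2 * k)\<bar> * pi < 2 * pi" by linarith
      hence "\<bar>real_of_int (2 * k)\<bar> < 2"
        by (simp only: mult_less_cancel_right_pos[OF pi_gt_zero])
      hence "k = 0" by linarith
      hence "w i * u = 0" using k by (simp add: complex_eq_iff)
      thus False using u w[OF i] by auto
    qed
    have "h i holomorphic_on ball 0 R - {0}"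
    proof -
      have "(\<lambda>u. w i * u / (exp (w i * u) - 1)) holomorphic_on ball 0 R - {0}"
        using nz by (intro holomorphic_intros) auto
      thus ?thesis by (rule holomorphic_transform) (auto simp: h_def)
    qed
    moreover have "h i analytic_on {0}"
      using hexp[OF i] has_fps_expansion_imp_analytic_0 by blast
    ultimately have "h i analytic_on (ball 0 R - {0}) \<union> {0}"
      by (auto simp only: analytic_on_Un analytic_on_open open_delete open_ball)
    thus ?thesis by (rule analytic_imp_holomorphic[OF analytic_on_subset]) auto
  qed
  have "F holomorphic_on ball 0 R"
    unfolding F_def by (intro holomorphic_intros hol) auto
  hence "(\<lambda>n. fps_nth (fps_exp a * (\<Prod>i=1..d. fps_const (w i) * fps_X / (fps_exp (w i) - 1))) n
            * z ^ n) sums F z"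
    using Fexp R(1)
    by (intro has_fps_expansion_imp_sums_complex[where r = "ereal R"]) (auto simp: eball_def ball_def)
  moreover have "F z = z ^ d * exp (a * z) * (\<Prod>i=1..d. w i / (exp (w i * z) - 1))"
  proof -
    have "(\<Prod>i=1..d. h i z) = (\<Prod>i=1..d. z * (w i / (exp (w i * z) - 1)))"
      using z(1) by (intro prod.cong) (auto simp: h_def)
    also have "\<dots> = z ^ d * (\<Prod>i=1..d. w i / (exp (w i * z) - 1))"
      by (subst prod.distrib) simp
    finally show ?thesis by (simp add: F_def)
  qed
  ultimately show ?thesis by (simp add: higher_bernoulli_def)
qed

lemma pderiv_sum_aux:
  fixes f :: "'b \<Rightarrow> 'a :: {comm_semiring_1, semiring_no_zero_divisors} poly"
  shows "pderiv (sum f A) = (\<Sum>i\<in>A. pderiv (f i))"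
  by (induction A rule: infinite_finite_induct) (simp_all add: pderiv_add)

lemma bernoullian_props:
  "poly (bernoullian d w n) 0 = 0"
  "poly (pderiv (bernoullian d w n)) a =
     fact n / (fact (n + d - 1) * (\<Prod>i=1..d. w i)) * higher_bernoulli d w (n + d - 1) a"
proof -
  define Q where "Q = (\<Prod>i=1..d. fps_const (w i) * fps_X / (fps_exp (w i) - 1))"
  define N where "N = n + d - 1"
  define c :: complex where "c = fact n / (fact N * (\<Prod>i=1..d. w i)) * fact N"
  define p where "p = (\<Sum>i\<le>N. monom (c * fps_nth Q (N - i) / fact (Suc i)) (Suc i))"
  let ?P = "\<lambda>p. poly p 0 = 0 \<and> (\<forall>a. poly (pderiv p) a =
     fact n / (fact (n + d - 1) * (\<Prod>i=1..d. w i)) * higher_bernoulli d w (n + d - 1) a)"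
  have P: "?P p"
  proof (intro conjI allI)
    show "poly p 0 = 0" by (simp add: p_def poly_sum poly_monom)
    fix a
    have "pderiv p = (\<Sum>i\<le>N. monom (c * fps_nth Q (N - i) / fact i) i)"
      unfolding p_def pderiv_sum_aux
      by (intro sum.cong) (auto simp: pderiv_monom simp del: of_nat_Suc)
    hence "poly (pderiv p) a = c * (\<Sum>i\<le>N. a ^ i / fact i * fps_nth Q (N - i))"
      by (simp add: poly_sum poly_monom sum_distrib_left algebra_simps)
    also have "\<dots> = c * fps_nth (fps_exp a * Q) N"
      by (simp add: fps_mult_nth atLeast0AtMost)
    finally show "poly (pderiv p) a =
       fact n / (fact (n + d - 1) * (\<Prod>i=1..d. w i)) * higher_bernoulli d w (n + d - 1) a"
      by (simp add: higher_bernoulli_def c_def N_def Q_def)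
  qed
  have "r = p" if r: "?P r" for r
  proof -
    have "pderiv r = pderiv p" using r P by (intro poly_ext) simp
    hence "pderiv (r - p) = 0" by (simp add: pderiv_diff)
    then obtain k where "r - p = [:k:]" by (metis pderiv_iszero)
    moreover have "poly (r - p) 0 = 0" using r P by simp
    ultimately show "r = p" by simp
  qed
  hence "?P (bernoullian d w n)"
    unfolding bernoullian_def by (rule theI[of ?P, OF P])
  thus "poly (bernoullian d w n) 0 = 0"
    "poly (pderiv (bernoullian d w n)) a =
     fact n / (fact (n + d - 1) * (\<Prod>i=1..d. w i)) * higher_bernoulli d w (n + d - 1) a"
    by auto
qed

end

theory Submission
  imports Defs
begin

text \<open>Let \<open>\<Delta>\<close> be the operator \<open>G_op\<close> applied to shifts by \<open>w\<close>, so formally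
  \<open>\<Delta> = \<Prod>\<^sub>i (exp (w\<^sub>i D) - 1)\<close> with \<open>D = d/dx\<close>. If \<open>c\<^sub>m\<close> are the power series coefficients of
  \<open>\<Prod>\<^sub>i z / (exp (w\<^sub>i z) - 1)\<close>, then \<open>\<Delta> (\<Sum>\<^sub>m c\<^sub>m D\<^sup>m g)\<close> agrees with the \<open>d\<close>-th derivative of \<open>g\<close>;
  truncating at \<open>m < M\<close> and Taylor expanding to order \<open>M + d\<close> leaves an error governed by the derivative
  of that order. For \<open>g x = x\<close> to the power \<open>d - \<alpha>\<close> the \<open>d\<close>-th derivative is
  \<open>\<Prod>\<^sub>j (j - \<alpha>)\<close> times \<open>x\<close> to the power \<open>-\<alpha>\<close>, and the error is summable over the lattice
  for \<open>Re \<alpha> > d - M\<close>, while the sum of \<open>\<Delta> F (a + n \<cdot> w)\<close> telescopes to \<open>(-1)\<^sup>d F a\<close>. This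
  continues \<open>\<Prod>\<^sub>j (j - \<alpha>)\<close> times the zeta function to an entire function. At \<open>\<alpha> = q\<close> one takes
  \<open>M = d - q + 1\<close>; the finite part is then a derivative in \<open>\<alpha>\<close>, computed term by term, and the
  non-logarithmic part of each term is a polynomial of degree below \<open>d\<close>, hence killed by \<open>\<Delta>\<close>.\<close>

section \<open>Sums over the lattice\<close>

text \<open>Split the power into \<open>d\<close> equal factors with exponent
  \<open>- s / d\<close>. Each base is at least \<open>1 + n i\<close>, so the term is dominated by
  a product of one-dimensional terms, and each of these series converges because
  \<open>s / d > 1\<close>.\<close>

lemma summable_on_nat_vecs_powr:
  fixes s :: real
  assumes "d \<ge> 1" "s > real d"
  shows "(\<lambda>n. (1 + (\<Sum>i=1..d. real (n i))) powr (-s)) summable_on nat_vecs d"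
proof -
  define f where "f = (\<lambda>k::nat. (1 + real k) powr (- s / real d))"
  have "- s / real d < - 1"
    using assms by (simp add: field_simps)
  then have "summable (\<lambda>k::nat. of_nat k powr (- s / real d) :: real)"
    by (subst summable_real_powr_iff)
  then have "summable f"
    unfolding f_def by (subst (asm) summable_Suc_iff[symmetric]) (simp add: add.commute)
  then have "f summable_on UNIV"
    by (subst summable_on_UNIV_nonneg_real_iff) (auto simp: f_def)
  then have "(\<lambda>k. norm (f k)) summable_on UNIV"
    by (simp add: f_def)
  then have "Infinite_Set_Sum.abs_summable_on f UNIV"
    by (subst abs_summable_equivalent[symmetric])
  then have "Infinite_Set_Sum.abs_summable_on (\<lambda>n. \<Prod>i\<in>{1..d}. f (n i)) (nat_vecs d)"
    unfolding nat_vecs_def by (intro abs_summable_on_prod_PiE) auto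
  then have "(\<lambda>n. norm (\<Prod>i\<in>{1..d}. f (n i))) summable_on (nat_vecs d)"
    by (subst abs_summable_equivalent)
  moreover have "(1 + (\<Sum>i=1..d. real (n i))) powr (-s) \<le> norm (\<Prod>i\<in>{1..d}. f (n i))" for n
  proof -
    define X where "X = 1 + (\<Sum>i=1..d. real (n i))"
    have X: "X \<ge> 1" by (simp add: X_def sum_nonneg)
    have "X powr (-s) = (X powr (- s / real d)) ^ d"
      using X assms by (simp add: powr_power)
    also have "\<dots> = (\<Prod>i\<in>{1..d}. X powr (- s / real d))"
      by simp
    also have "\<dots> \<le> (\<Prod>i\<in>{1..d}. f (n i))"
    proof (intro prod_mono conjI)
      fix i assume i: "i \<in> {1..d}"
      have "real (n i) \<le> (\<Sum>i=1..d. real (n i))"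
        using i by (intro member_le_sum) auto
      then show "X powr (- s / real d) \<le> f (n i)"
        unfolding f_def X_def using assms by (intro powr_mono2') auto
    qed auto
    also have "\<dots> \<le> norm (\<Prod>i\<in>{1..d}. f (n i))" by simp
    finally show ?thesis by (simp add: X_def)
  qed
  ultimately show ?thesis
    by (rule summable_on_comparison_test) auto
qed

text \<open>The Weierstrass test makes the finite partial sums converge uniformly on the closed
  ball, and a uniform limit of holomorphic functions may be differentiated term by term.\<close>

lemma infsum_has_field_derivative:
  fixes f :: "'a \<Rightarrow> complex \<Rightarrow> complex"
  assumes hol: "\<And>x. x \<in> X \<Longrightarrow> f x holomorphic_on ball z r"
    and cont: "\<And>x. x \<in> X \<Longrightarrow> continuous_on (cball z r) (f x)"
    and r: "r > 0" and M: "M summable_on X"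
    and bd: "\<And>x y. x \<in> X \<Longrightarrow> y \<in> cball z r \<Longrightarrow> norm (f x y) \<le> M x"
  obtains D where "((\<lambda>y. \<Sum>\<^sub>\<infinity>x\<in>X. f x y) has_field_derivative D) (at z)"
    "((\<lambda>x. deriv (f x) z) has_sum D) X"
proof -
  have ul: "uniform_limit (cball z r) (\<lambda>F y. \<Sum>x\<in>F. f x y) (\<lambda>y. \<Sum>\<^sub>\<infinity>x\<in>X. f x y) (finite_subsets_at_top X)"
    by (rule Weierstrass_m_test_general[OF bd M])
  have ev: "eventually (\<lambda>F. continuous_on (cball z r) (\<lambda>y. \<Sum>x\<in>F. f x y) \<and>
      (\<forall>w \<in> ball z r. ((\<lambda>y. \<Sum>x\<in>F. f x y) has_field_derivative (\<Sum>x\<in>F. deriv (f x) w)) (at w)))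
      (finite_subsets_at_top X)"
  proof (rule eventually_finite_subsets_at_top_weakI, intro conjI ballI)
    fix F assume F: "finite F" "F \<subseteq> X"
    show "continuous_on (cball z r) (\<lambda>y. \<Sum>x\<in>F. f x y)"
      using F cont by (intro continuous_intros) auto
    fix w assume w: "w \<in> ball z r"
    show "((\<lambda>y. \<Sum>x\<in>F. f x y) has_field_derivative (\<Sum>x\<in>F. deriv (f x) w)) (at w)"
      using F hol w by (intro DERIV_sum holomorphic_derivI[OF _ open_ball]) auto
  qed
  obtain g' where g': "\<And>w. w \<in> ball z r \<Longrightarrow> ((\<lambda>y. \<Sum>\<^sub>\<infinity>x\<in>X. f x y) has_field_derivative (g' w)) (at w) \<and>
      ((\<lambda>F. \<Sum>x\<in>F. deriv (f x) w) \<longlongrightarrow> g' w) (finite_subsets_at_top X)"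
    by (rule has_complex_derivative_uniform_limit[OF ev ul finite_subsets_at_top_neq_bot r]) blast
  show ?thesis
    using g'[of z] r by (intro that[of "g' z"]) (auto simp: has_sum_def)
qed

section \<open>Meromorphic functions\<close>

text \<open>Division by \<open>z - q\<close> shifts the Taylor series of \<open>h\<close> by one
  place, so the constant Laurent coefficient of \<open>f\<close> is the linear Taylor coefficient of
  \<open>h\<close>. The removable case \<open>h q = 0\<close> is included.\<close>

lemma finite_part_simple_pole:
  assumes h: "h analytic_on {q}"
    and f: "eventually (\<lambda>z. f z = h z / (z - q)) (at q)"
  shows "finite_part f q = deriv h q"
proof -
  have "(\<lambda>z. h (q + z)) has_fps_expansion fps_expansion h q"
    using h by (rule analytic_at_imp_has_fps_expansion)
  then have "(\<lambda>z. h (q + z)) has_laurent_expansion fps_to_fls (fps_expansion h q)"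
    by (rule has_laurent_expansion_fps)
  from has_laurent_expansion_shift'[OF this, of 1]
  have "(\<lambda>z. h (q + z) * z powi (-1)) has_laurent_expansion fls_shift 1 (fps_to_fls (fps_expansion h q))"
    by simp
  also have "?this \<longleftrightarrow> (\<lambda>z. f (q + z)) has_laurent_expansion fls_shift 1 (fps_to_fls (fps_expansion h q))"
  proof (rule has_laurent_expansion_cong[OF _ refl])
    have "eventually (\<lambda>z. f (q + z) = h (q + z) / (q + z - q)) (at 0)"
    proof -
      have "eventually (\<lambda>z. f z = h z / (z - q)) (filtermap (\<lambda>x. x + q) (at 0))"
        by (rule subst[OF at_to_0[of q], of "eventually _"]) (rule f)
      then show ?thesis by (simp only: eventually_filtermap add.commute[of _ q])
    qed
    then show "eventually (\<lambda>z. h (q + z) * z powi (-1) = f (q + z)) (at 0)"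
      by eventually_elim (simp add: power_int_minus field_simps)
  qed
  finally have "laurent_expansion f q = fls_shift 1 (fps_to_fls (fps_expansion h q))"
    by (rule laurent_expansion_eqI)
  then show ?thesis
    by (simp add: finite_part_def fps_expansion_def)
qed

text \<open>Uniqueness of the continuation, needed to evaluate the definite description in
  \<open>barnes_zeta\<close>. The identity theorem yields agreement on a punctured neighbourhood of
  every point; niceness then fixes the value at the point itself.\<close>

lemma nicely_meromorphic_eq_UNIV:
  assumes f: "f nicely_meromorphic_on UNIV" and g: "g nicely_meromorphic_on UNIV"
    and U: "open U" "U \<noteq> {}" and eq: "\<And>z. z \<in> U \<Longrightarrow> f z = g z"
  shows "f = g"
proof
  fix z
  let ?h = "remove_sings (\<lambda>z. f z - g z)"
  have mero: "f meromorphic_on UNIV" "g meromorphic_on UNIV"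
    using f g by (auto simp: nicely_meromorphic_on_def)
  then have m: "(\<lambda>z. f z - g z) meromorphic_on UNIV" by (intro meromorphic_intros)
  then have n: "?h nicely_meromorphic_on UNIV" by (rule remove_sings_nicely_meromorphic)
  obtain u where u: "u \<in> U" using U by blast
  have "?h w = 0" if "w \<in> U" for w
  proof (rule remove_sings_eqI)
    have "eventually (\<lambda>v. f v - g v = 0) (at w)"
      using eventually_at_in_open'[OF U(1) that] by eventually_elim (simp add: eq)
    then show "(\<lambda>z. f z - g z) \<midarrow>w\<rightarrow> 0" by (rule tendsto_eventually)
  qed
  then have "eventually (\<lambda>w. ?h w = 0) (at u)"
    by (rule eventually_mono[OF eventually_at_in_open'[OF U(1) u]])
  then have fr: "frequently (\<lambda>w. ?h w = 0) (at u)"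
    by (rule eventually_frequently[OF at_neq_bot])
  have h0: "?h w = 0" for w
    by (rule frequently_eq_meromorphic_imp_constant[OF fr n open_UNIV connected_UNIV UNIV_I UNIV_I])
  have "eventually (\<lambda>w. ?h w = f w - g w) (at z)"
    using m by (intro eventually_remove_sings_eq_at meromorphic_on_isolated_singularity)
       (auto intro: meromorphic_on_subset)
  then have ev: "eventually (\<lambda>w. f w = g w) (at z)"
    by eventually_elim (simp add: h0)
  then have poles: "is_pole f z \<longleftrightarrow> is_pole g z" and lims: "(f \<midarrow>z\<rightarrow> f z) \<longleftrightarrow> (g \<midarrow>z\<rightarrow> f z)"
    by (auto intro!: is_pole_cong tendsto_cong)
  have fz: "is_pole f z \<and> f z = 0 \<or> f \<midarrow>z\<rightarrow> f z" and gz: "is_pole g z \<and> g z = 0 \<or> g \<midarrow>z\<rightarrow> g z"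
    using f g by (auto simp: nicely_meromorphic_on_def)
  show "f z = g z"
  \<comment> \<open>At a common pole both values are normalised to 0; elsewhere both are the limit
    of the same punctured germ.\<close>
  proof (cases "is_pole f z")
    case True
    then have "\<not> f \<midarrow>z\<rightarrow> f z" "\<not> g \<midarrow>z\<rightarrow> g z"
      using poles not_tendsto_and_filterlim_at_infinity[of "at z"] by (auto simp: is_pole_def)
    with fz gz show ?thesis by simp
  next
    case False
    with poles fz gz lims have "g \<midarrow>z\<rightarrow> f z" "g \<midarrow>z\<rightarrow> g z" by auto
    then show ?thesis by (rule LIM_unique)
  qed
qed

section \<open>Bernoulli coefficients and the difference operator\<close>

text \<open>For nonzero \<open>w i\<close> these are the Bernoulli numbers
  \<open>B_m(0|w) / (m! * \<Prod>i. w i)\<close>: the numerators \<open>w i\<close> of the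
  generating function are left out.\<close>

definition todd_coeff :: "nat \<Rightarrow> (nat \<Rightarrow> complex) \<Rightarrow> nat \<Rightarrow> complex" where
  "todd_coeff d w m = fps_nth (\<Prod>i=1..d. fps_X / (fps_exp (w i) - 1)) m"

lemma subdegree_fps_exp_minus_1:
  assumes "(c::complex) \<noteq> 0" shows "subdegree (fps_exp c - 1) = 1"
  using assms by (intro subdegreeI) auto

lemma fps_exp_minus_1_dvd_X:
  assumes "(c::complex) \<noteq> 0" shows "fps_exp c - 1 dvd fps_X"
proof -
  have "fps_exp c - 1 \<noteq> 0" using subdegree_fps_exp_minus_1[OF assms] by auto
  then show ?thesis
    using subdegree_fps_exp_minus_1[OF assms] by (subst fps_dvd_iff) auto
qed

lemma prod_fps_const: "(\<Prod>i\<in>A. fps_const (f i)) = fps_const (\<Prod>i\<in>A. f i :: 'a :: field)"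
  by (induction A rule: infinite_finite_induct) auto

text \<open>The first derivative is an explicit polynomial with coefficients
  \<open>c * fps_nth Q (N - i) / fact i\<close>. The remaining \<open>d - 1\<close> derivatives at 0
  select \<open>i = d - 1\<close>, where \<open>N - i = m\<close>; the factor \<open>W\<close> in
  \<open>Q\<close> cancels the one in \<open>c\<close>.\<close>

lemma bernoullian_higher_deriv:
  assumes d: "d \<ge> 1" and w: "\<And>i. i \<in> {1..d} \<Longrightarrow> w i \<noteq> 0"
  shows "poly ((pderiv ^^ d) (bernoullian d w m)) 0 = fact m * todd_coeff d w m"
proof -
  define Q where "Q = (\<Prod>i=1..d. fps_const (w i) * fps_X / (fps_exp (w i) - 1))"
  define N where "N = m + d - 1"
  define W where "W = (\<Prod>i=1..d. w i)"
  have W: "W \<noteq> 0" unfolding W_def using w by simp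
  define c :: complex where "c = fact m / W"
  define P where "P = (\<Sum>i\<le>N. monom (c * fps_nth Q (N - i) / fact i) i)"
  have "Q = (\<Prod>i=1..d. fps_const (w i) * (fps_X / (fps_exp (w i) - 1)))"
    unfolding Q_def
  proof (rule prod.cong[OF refl])
    fix i assume "i \<in> {1..d}"
    then have "fps_exp (w i) - 1 dvd (fps_X :: complex fps)"
      by (intro fps_exp_minus_1_dvd_X w)
    then show "fps_const (w i) * fps_X / (fps_exp (w i) - 1) = fps_const (w i) * (fps_X / (fps_exp (w i) - 1))"
      by (simp add: div_mult_swap)
  qed
  then have "Q = fps_const W * (\<Prod>i=1..d. fps_X / (fps_exp (w i) - 1))"
    by (simp add: prod.distrib W_def prod_fps_const)
  then have Qm: "fps_nth Q m = W * todd_coeff d w m"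
    by (simp add: todd_coeff_def)
  have "pderiv (bernoullian d w m) = P"
  proof (rule poly_ext)
    fix x
    have "poly P x = c * (\<Sum>i\<le>N. x ^ i / fact i * fps_nth Q (N - i))"
      by (simp add: P_def poly_sum poly_monom sum_distrib_left algebra_simps)
    also have "\<dots> = c * fps_nth (fps_exp x * Q) N"
      by (simp add: fps_mult_nth atLeast0AtMost)
    finally show "poly (pderiv (bernoullian d w m)) x = poly P x"
      unfolding bernoullian_props(2) by (simp add: higher_bernoulli_def c_def N_def Q_def W_def)
  qed
  moreover obtain k where k: "d = Suc k" using d by (cases d) auto
  moreover have "coeff P k = c * fps_nth Q m / fact k"
  proof -
    have "N - k = m" "k \<le> N" using k by (auto simp: N_def)
    then show ?thesis
      unfolding P_def by (simp add: coeff_sum)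
  qed
  ultimately have "poly ((pderiv ^^ d) (bernoullian d w m)) 0 = pochhammer 1 k * (c * fps_nth Q m / fact k)"
    by (simp add: funpow_Suc_right poly_0_coeff_0 coeff_higher_pderiv del: funpow.simps)
  also have "\<dots> = c * fps_nth Q m"
    by (simp add: pochhammer_fact[symmetric])
  finally show ?thesis
    using W by (simp add: Qm c_def)
qed

text \<open>Each \<open>fps_exp (w i) - 1\<close> has order exactly one, hence divides
  \<open>fps_X\<close>, and the quotients cancel factor by factor.\<close>

lemma todd_coeff_mult_prod_exp:
  assumes w: "\<And>i. i \<in> {1..d} \<Longrightarrow> w i \<noteq> 0"
  shows "Abs_fps (todd_coeff d w) * (\<Prod>i=1..d. fps_exp (w i) - 1) = fps_X ^ d"
proof -
  have "Abs_fps (todd_coeff d w) = (\<Prod>i=1..d. fps_X / (fps_exp (w i) - 1))"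
    by (simp add: fps_eq_iff todd_coeff_def)
  then have "Abs_fps (todd_coeff d w) * (\<Prod>i=1..d. fps_exp (w i) - 1) =
      (\<Prod>i=1..d. (fps_X / (fps_exp (w i) - 1)) * (fps_exp (w i) - 1))"
    by (simp add: prod.distrib)
  also have "\<dots> = (\<Prod>i=1..d. fps_X)"
  proof (rule prod.cong[OF refl])
    fix i assume "i \<in> {1..d}"
    then have "fps_exp (w i) - 1 dvd (fps_X :: complex fps)"
      by (intro fps_exp_minus_1_dvd_X w)
    then show "fps_X / (fps_exp (w i) - 1) * (fps_exp (w i) - 1) = fps_X" by simp
  qed
  finally show ?thesis by simp
qed

text \<open>Multiplying out the product over subsets gives signed exponentials of the subset sums.
  This is the formal counterpart of writing the difference operator as a product of
  \<open>exp (w i * D) - 1\<close>.\<close>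

lemma G_op_power_eq_fps:
  "G_op d (\<lambda>x. x ^ k / fact k) w = fps_nth (\<Prod>i=1..d. fps_exp (w i) - 1) k"
proof -
  have "(\<Prod>i=1..d. fps_exp (w i) - 1) = (\<Prod>i\<in>{1..d}. fps_exp (w i) + (-1))" by simp
  also have "\<dots> = (\<Sum>S\<in>Pow {1..d}. (\<Prod>i\<in>S. fps_exp (w i)) * (\<Prod>i\<in>{1..d} - S. -1))"
    by (rule prod_add) simp
  also have "\<dots> = (\<Sum>S\<in>Pow {1..d}. fps_const ((-1) ^ (d - card S)) * fps_exp (\<Sum>i\<in>S. w i))"
  proof (rule sum.cong[OF refl])
    fix S assume "S \<in> Pow {1..d}"
    then have S: "S \<subseteq> {1..d}" "finite S" by (auto intro: finite_subset)
    have "(\<Prod>i\<in>S. fps_exp (w i)) = fps_exp (\<Sum>i\<in>S. w i)"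
      using S(2) by (induction S) (auto simp: fps_exp_add_mult)
    moreover have "card ({1..d} - S) = d - card S"
      using S by (simp add: card_Diff_subset)
    ultimately show "(\<Prod>i\<in>S. fps_exp (w i)) * (\<Prod>i\<in>{1..d} - S. -1) =
        fps_const ((-1) ^ (d - card S)) * fps_exp (\<Sum>i\<in>S. w i)"
      by (simp add: fps_const_power[symmetric] fps_const_neg[symmetric] del: fps_const_neg fps_const_power)
  qed
  finally show ?thesis
    by (simp add: G_op_def fps_sum_nth)
qed

lemma fps_X_dvd_if_nth_0:
  fixes F :: "'a :: field fps"
  assumes "fps_nth F 0 = 0" shows "fps_X dvd F"
proof -
  have "F = fps_X * fps_shift 1 F"
    using assms by (simp add: fps_eq_iff)
  then show ?thesis by (rule dvdI)
qed

text \<open>Every factor \<open>fps_exp (w i) - 1\<close> has zero constant term, so the product of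
  the \<open>d\<close> factors is divisible by \<open>fps_X ^ d\<close>.\<close>

lemma G_op_power_eq_0:
  assumes "k < d" shows "G_op d (\<lambda>x. x ^ k / fact k) w = 0"
proof -
  have "(\<Prod>i=1..d. fps_X) dvd (\<Prod>i=1..d. fps_exp (w i) - (1 :: complex fps))"
    by (intro prod_dvd_prod fps_X_dvd_if_nth_0) auto
  then have "fps_X ^ d dvd (\<Prod>i=1..d. fps_exp (w i) - (1 :: complex fps))" by simp
  then obtain F where "(\<Prod>i=1..d. fps_exp (w i) - (1 :: complex fps)) = fps_X ^ d * F" by (elim dvdE)
  then show ?thesis
    using assms by (simp add: G_op_power_eq_fps fps_X_power_mult_nth)
qed

lemma G_op_add: "G_op d (\<lambda>x. f x + g x) w = G_op d f w + G_op d g w"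
  by (simp add: G_op_def sum.distrib algebra_simps)

lemma G_op_cmult: "G_op d (\<lambda>x. c * f x) w = c * G_op d f w"
  by (simp add: G_op_def sum_distrib_left algebra_simps)

lemma G_op_sum: "G_op d (\<lambda>x. \<Sum>k\<in>A. f k x) w = (\<Sum>k\<in>A. G_op d (f k) w)"
  unfolding G_op_def sum_distrib_left by (rule sum.swap)

lemma G_op_shift_power_eq_0:
  assumes "k < d" shows "G_op d (\<lambda>x. (b + x) ^ k) w = 0"
proof -
  have "(\<lambda>x. (b + x) ^ k) = (\<lambda>x. \<Sum>j\<le>k. (of_nat (k choose j) * b ^ (k - j) * fact j) * (x ^ j / fact j))"
    by (intro ext) (subst add.commute, simp add: binomial_ring field_simps)
  then have "G_op d (\<lambda>x. (b + x) ^ k) w =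
      (\<Sum>j\<le>k. (of_nat (k choose j) * b ^ (k - j) * fact j) * G_op d (\<lambda>x. x ^ j / fact j) w)"
    by (simp only: G_op_sum G_op_cmult)
  also have "\<dots> = 0"
    using assms by (intro sum.neutral ballI) (simp only: atMost_iff G_op_power_eq_0[OF le_less_trans] mult_zero_right)
  finally show ?thesis .
qed

text \<open>This is coefficient \<open>j\<close> of the product identity above. Truncation at
  \<open>M\<close> costs nothing for \<open>j < M + d\<close>: an omitted \<open>m \<ge> M\<close>
  leaves a power \<open>j - m < d\<close>, which the difference operator kills.\<close>

lemma todd_coeff_G_op_convolution:
  assumes w: "\<And>i. i \<in> {1..d} \<Longrightarrow> w i \<noteq> 0" and j: "j < M + d"
  shows "(\<Sum>m\<in>{m. m < M \<and> m \<le> j}. todd_coeff d w m * G_op d (\<lambda>x. x ^ (j - m) / fact (j - m)) w) = (if j = d then 1 else 0)"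
proof -
  have "(\<Sum>m\<in>{m. m < M \<and> m \<le> j}. todd_coeff d w m * G_op d (\<lambda>x. x ^ (j - m) / fact (j - m)) w) =
     (\<Sum>m\<in>{0..j}. todd_coeff d w m * G_op d (\<lambda>x. x ^ (j - m) / fact (j - m)) w)"
  proof (rule sum.mono_neutral_left)
    show "\<forall>m\<in>{0..j} - {m. m < M \<and> m \<le> j}. todd_coeff d w m * G_op d (\<lambda>x. x ^ (j - m) / fact (j - m)) w = 0"
    proof
      fix m assume "m \<in> {0..j} - {m. m < M \<and> m \<le> j}"
      then have "j - m < d" using j by auto
      then show "todd_coeff d w m * G_op d (\<lambda>x. x ^ (j - m) / fact (j - m)) w = 0"
        by (simp only: G_op_power_eq_0 mult_zero_right)
    qed
  qed auto
  also have "\<dots> = fps_nth (Abs_fps (todd_coeff d w) * (\<Prod>i=1..d. fps_exp (w i) - 1)) j"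
    by (simp add: G_op_power_eq_fps fps_mult_nth)
  also have "\<dots> = (if j = d then 1 else 0)"
    by (subst todd_coeff_mult_prod_exp[OF w]) (auto simp: fps_X_power_nth)
  finally show ?thesis .
qed

section \<open>The half-plane and the logarithm\<close>

text \<open>The signed distance of \<open>z\<close> from the boundary line of the half-plane,
  obtained by rotating that half-plane onto \<open>Re z > 0\<close>. Being real-linear, it behaves
  well on lattice sums, unlike the argument.\<close>

definition half_height :: "real \<Rightarrow> complex \<Rightarrow> real" where
  "half_height \<theta> z = Re (cis (-\<theta>) * z)"

lemma half_height_add: "half_height \<theta> (x + y) = half_height \<theta> x + half_height \<theta> y"
  by (simp add: half_height_def distrib_left)

lemma half_height_of_nat: "half_height \<theta> (of_nat n * x) = real n * half_height \<theta> x"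
  by (simp add: half_height_def algebra_simps)

lemma half_height_sum: "half_height \<theta> (\<Sum>i\<in>A. f i) = (\<Sum>i\<in>A. half_height \<theta> (f i))"
  by (simp only: half_height_def sum_distrib_left Re_sum)

lemma half_height_le_norm: "half_height \<theta> x \<le> norm x"
  unfolding half_height_def using complex_Re_le_cmod[of "cis (-\<theta>) * x"] by (simp only: norm_mult norm_cis mult_1)

lemma half_height_linear: "linear (half_height \<theta>)"
  by (rule linearI) (simp_all add: half_height_def algebra_simps)

lemma convex_half_height: "convex {y. half_height \<theta> y \<ge> c}" "convex {y. half_height \<theta> y > c}"
  using convex_linear_vimage[OF half_height_linear, of "{c..}" \<theta>]
    convex_linear_vimage[OF half_height_linear, of "{c<..}" \<theta>]
  by (simp_all add: vimage_def)

lemma half_plane_eq: "half_plane \<theta> = {z. half_height \<theta> z > 0}"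
proof (intro set_eqI iffI)
  fix z assume "z \<in> half_plane \<theta>"
  then obtain r t where z: "z = complex_of_real r * cis t" and rt: "r > 0" "\<theta> - pi/2 < t" "t < \<theta> + pi/2"
    by (auto simp: half_plane_def)
  have "cis (-\<theta>) * z = complex_of_real r * cis (t - \<theta>)"
    by (simp add: z cis_mult mult.left_commute[of "cis (-\<theta>)"])
  then have "half_height \<theta> z = r * cos (t - \<theta>)"
    by (simp add: half_height_def)
  moreover have "cos (t - \<theta>) > 0"
    using rt by (intro cos_gt_zero_pi) auto
  ultimately show "z \<in> {z. half_height \<theta> z > 0}" using rt by simp
next
  fix z assume "z \<in> {z. half_height \<theta> z > 0}"
  then have pos: "Re (cis (-\<theta>) * z) > 0" by (simp add: half_height_def)
  define u where "u = cis (-\<theta>) * z"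
  have u0: "u \<noteq> 0" using pos by (auto simp: u_def)
  have "\<bar>Im (Ln u)\<bar> < pi / 2" using pos Re_Ln_pos_lt[OF u0] by (simp only: u_def[symmetric])
  moreover have "z = complex_of_real (exp (Re (Ln u))) * cis (\<theta> + Im (Ln u))"
  proof -
    have "u = complex_of_real (exp (Re (Ln u))) * cis (Im (Ln u))"
      using u0 exp_eq_polar[of "Ln u"] by simp
    moreover have "z = cis \<theta> * u" by (simp add: u_def mult.assoc[symmetric] cis_mult)
    ultimately show ?thesis by (metis cis_mult mult.left_commute)
  qed
  ultimately have "z = complex_of_real (exp (Re (Ln u))) * cis (\<theta> + Im (Ln u)) \<and> exp (Re (Ln u)) > 0 \<and>
      \<theta> - pi / 2 < \<theta> + Im (Ln u) \<and> \<theta> + Im (Ln u) < \<theta> + pi / 2"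
    by auto
  then show "z \<in> half_plane \<theta>"
    unfolding half_plane_def by blast
qed

lemma continuous_half_height: "continuous_on A (half_height \<theta>)"
  unfolding half_height_def by (intro continuous_intros)

lemma open_half_plane: "open (half_plane \<theta>)"
  unfolding half_plane_eq by (intro open_Collect_less continuous_half_height continuous_intros)

text \<open>Differentiate the identity \<open>exp (L y) = y\<close>.\<close>

lemma log_branch_has_field_derivative:
  assumes L: "log_branch_on H L" and H: "open H" and z: "z \<in> H"
  shows "(L has_field_derivative 1 / z) (at z)"
proof -
  have eq: "exp (L y) = y" if "y \<in> H" for y using L that by (simp add: log_branch_on_def)
  have D: "(L has_field_derivative deriv L z) (at z)"
    using L z H by (auto simp: log_branch_on_def intro: holomorphic_derivI)
  have "((\<lambda>y. exp (L y)) has_field_derivative exp (L z) * deriv L z) (at z)"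
    by (rule derivative_eq_intros D refl)+
  then have "((\<lambda>y. y) has_field_derivative exp (L z) * deriv L z) (at z)"
    by (rule has_field_derivative_transform_within_open[OF _ H z]) (simp add: eq)
  then have "z * deriv L z = 1"
    using DERIV_unique[OF _ DERIV_ident] eq[OF z] by simp
  moreover have "z \<noteq> 0" using eq[OF z] by (metis exp_not_eq_zero)
  ultimately have "deriv L z = 1 / z" by (simp add: field_simps)
  with D show ?thesis by simp
qed

text \<open>On the convex half-plane, \<open>L\<close> and the principal logarithm rotated by
  \<open>-\<theta>\<close> have the same derivative, so they differ by a constant, and the principal
  logarithm has imaginary part at most \<open>pi\<close> in absolute value.\<close>

lemma log_branch_Im_bounded:
  assumes L: "log_branch_on (half_plane \<theta>) L"
  shows "\<exists>C\<ge>0. \<forall>z\<in>half_plane \<theta>. \<bar>Im (L z)\<bar> \<le> C"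
proof -
  have der: "((\<lambda>z. L z - Ln (cis (-\<theta>) * z)) has_field_derivative 0) (at z within half_plane \<theta>)"
    if z: "z \<in> half_plane \<theta>" for z
  proof -
    have pos: "Re (cis (-\<theta>) * z) > 0" using z by (simp add: half_plane_eq half_height_def)
    then have "cis (-\<theta>) * z \<notin> \<real>\<^sub>\<le>\<^sub>0" using complex_nonpos_Reals_iff by fastforce
    moreover have z0: "z \<noteq> 0" using pos by auto
    moreover have "cis \<theta> * inverse z * cis (-\<theta>) = (cis \<theta> * cis (-\<theta>)) * inverse z"
      by (simp only: mult_ac)
    then have "1 / z = cis \<theta> * inverse z * cis (-\<theta>)"
      by (simp add: cis_mult inverse_eq_divide)
    ultimately have "((\<lambda>z. L z - Ln (cis (-\<theta>) * z)) has_field_derivative 0) (at z)"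
      by (auto intro!: derivative_eq_intros log_branch_has_field_derivative[OF L open_half_plane z])
    then show ?thesis by (rule has_field_derivative_at_within)
  qed
  have "convex (half_plane \<theta>)" using convex_half_height by (simp add: half_plane_eq)
  from has_field_derivative_zero_constant[OF this der]
  obtain c where c: "\<And>z. z \<in> half_plane \<theta> \<Longrightarrow> L z - Ln (cis (-\<theta>) * z) = c" by blast
  have "\<bar>Im (L z)\<bar> \<le> \<bar>Im c\<bar> + pi" if z: "z \<in> half_plane \<theta>" for z
  proof -
    have "L z = c + Ln (cis (-\<theta>) * z)" using c[OF z] by (simp add: algebra_simps)
    then have "\<bar>Im (L z)\<bar> \<le> \<bar>Im c\<bar> + \<bar>Im (Ln (cis (-\<theta>) * z))\<bar>" by simp
    moreover have "cis (-\<theta>) * z \<noteq> 0" using z by (auto simp: half_plane_eq half_height_def)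
    then have "\<bar>Im (Ln (cis (-\<theta>) * z))\<bar> \<le> pi"
      using mpi_less_Im_Ln[of "cis (-\<theta>) * z"] Im_Ln_le_pi[of "cis (-\<theta>) * z"] by linarith
    ultimately show ?thesis by linarith
  qed
  then show ?thesis by (intro exI[of _ "\<bar>Im c\<bar> + pi"]) auto
qed

section \<open>Analytic continuation of the Barnes zeta function\<close>

definition falling :: "nat \<Rightarrow> complex \<Rightarrow> complex" where
  "falling k s = (\<Prod>j<k. s - of_nat j)"

locale barnes =
  fixes \<theta> :: real and L :: "complex \<Rightarrow> complex"
    and d :: nat and a :: complex and w :: "nat \<Rightarrow> complex"
  assumes L: "log_branch_on (half_plane \<theta>) L"
    and d: "d \<ge> 1"
    and a: "a \<in> half_plane \<theta>"
    and w: "\<And>i. i \<in> {1..d} \<Longrightarrow> w i \<in> half_plane \<theta>"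
begin

section \<open>Complex powers on the half-plane: size, Taylor expansion and truncation error\<close>

abbreviation "ht \<equiv> half_height \<theta>"
abbreviation "H \<equiv> half_plane \<theta>"
abbreviation "todd \<equiv> todd_coeff d w"
abbreviation "node n \<equiv> a + ndot d n w"
abbreviation "wsum S \<equiv> (\<Sum>i\<in>S. w i)"

lemma mem_H: "z \<in> H \<longleftrightarrow> ht z > 0" by (simp add: half_plane_eq)

lemma H_neq_0: "z \<in> H \<Longrightarrow> z \<noteq> 0" by (auto simp: mem_H half_height_def)

lemma exp_L: "z \<in> H \<Longrightarrow> exp (L z) = z" using L by (simp add: log_branch_on_def)

lemma w_neq_0: "i \<in> {1..d} \<Longrightarrow> w i \<noteq> 0" using w H_neq_0 by blast

definition im_bound :: real where "im_bound = (SOME C. C \<ge> 0 \<and> (\<forall>z\<in>H. \<bar>Im (L z)\<bar> \<le> C))"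

lemma im_bound: "z \<in> H \<Longrightarrow> \<bar>Im (L z)\<bar> \<le> im_bound" "im_bound \<ge> 0"
proof -
  have "\<exists>C. C \<ge> 0 \<and> (\<forall>z\<in>H. \<bar>Im (L z)\<bar> \<le> C)" using log_branch_Im_bounded[OF L] by blast
  from someI_ex[OF this] show "z \<in> H \<Longrightarrow> \<bar>Im (L z)\<bar> \<le> im_bound" "im_bound \<ge> 0"
    unfolding im_bound_def by auto
qed

text \<open>The modulus is \<open>norm z powr Re s\<close> times
  \<open>exp (- (Im s * Im (L z)))\<close>. The second factor is controlled by
  \<open>im_bound\<close>; the first decreases in \<open>norm z\<close>, which is at least
  \<open>ht z\<close>.\<close>

lemma norm_exp_L_le:
  assumes "\<rho> > 0" "ht z \<ge> \<rho>" "Re s \<le> 0"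
  shows "norm (exp (s * L z)) \<le> exp (im_bound * \<bar>Im s\<bar>) * \<rho> powr Re s"
proof -
  have z: "z \<in> H" using assms by (simp add: mem_H)
  have "norm z = exp (Re (L z))" using exp_L[OF z] by (metis norm_exp_eq_Re)
  then have ReL: "Re (L z) = ln (norm z)" by simp
  have nz: "norm z \<ge> \<rho>" using half_height_le_norm[of \<theta> z] assms by linarith
  have "- (Im s * Im (L z)) \<le> \<bar>Im s\<bar> * \<bar>Im (L z)\<bar>"
    by (simp add: abs_mult[symmetric])
  also have "\<dots> \<le> im_bound * \<bar>Im s\<bar>"
    using im_bound(1)[OF z] by (metis abs_ge_zero mult.commute mult_right_mono)
  finally have 1: "exp (- (Im s * Im (L z))) \<le> exp (im_bound * \<bar>Im s\<bar>)" by simp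
  have "norm (exp (s * L z)) = exp (- (Im s * Im (L z))) * norm z powr Re s"
    using nz assms H_neq_0[OF z] by (simp add: ReL powr_def exp_add[symmetric])
  also have "\<dots> \<le> exp (im_bound * \<bar>Im s\<bar>) * \<rho> powr Re s"
    using nz assms by (intro mult_mono 1 powr_mono2') auto
  finally show ?thesis .
qed

text \<open>The \<open>k\<close>-th derivative in \<open>z\<close> of \<open>exp (s * L z)\<close>.\<close>

definition dpow :: "nat \<Rightarrow> complex \<Rightarrow> complex \<Rightarrow> complex" where
  "dpow k s z = falling k s * exp ((s - of_nat k) * L z)"

lemma dpow_has_field_derivative:
  assumes "z \<in> H"
  shows "(dpow k s has_field_derivative dpow (Suc k) s z) (at z)"
proof -
  have "exp ((s - of_nat k) * L z) = exp ((s - of_nat (Suc k)) * L z) * exp (L z)"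
    by (simp add: exp_add[symmetric] algebra_simps)
  then have e: "exp ((s - of_nat k) * L z) = exp ((s - of_nat (Suc k)) * L z) * z"
    by (simp only: exp_L[OF assms])
  have "((\<lambda>z. falling k s * exp ((s - of_nat k) * L z)) has_field_derivative
      falling k s * (exp ((s - of_nat k) * L z) * ((s - of_nat k) * (1 / z)))) (at z)"
    by (rule derivative_eq_intros log_branch_has_field_derivative[OF L open_half_plane assms] refl)+ simp
  moreover have "falling k s * (exp ((s - of_nat k) * L z) * ((s - of_nat k) * (1 / z))) = dpow (Suc k) s z"
    unfolding e dpow_def using H_neq_0[OF assms] by (simp add: falling_def)
  ultimately show ?thesis
    unfolding dpow_def[abs_def] by simp
qed

lemma dpow_bound:
  assumes "\<rho> > 0" "ht z \<ge> \<rho>" "Re s \<le> real k"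
  shows "norm (dpow k s z) \<le> norm (falling k s) * (exp (im_bound * \<bar>Im s\<bar>) * \<rho> powr (Re s - real k))"
  unfolding dpow_def norm_mult
  using norm_exp_L_le[of \<rho> z "s - of_nat k"] assms by (intro mult_left_mono) auto

text \<open>The points at least as high as \<open>x\<close> form a convex set containing
  \<open>x + v\<close>, and on it the derivative of order \<open>K\<close> is bounded in terms of
  \<open>ht x\<close>. Taylor's theorem applies along this set.\<close>

lemma dpow_taylor:
  assumes x: "x \<in> H" and v: "ht v \<ge> 0" and s: "Re s \<le> real K" and m: "m < K"
  shows "norm (dpow m s (x + v) - (\<Sum>i<K - m. dpow (m + i) s x * (v ^ i / fact i))) \<le>
     norm (falling K s) * (exp (im_bound * \<bar>Im s\<bar>) * ht x powr (Re s - real K)) * norm v ^ (K - m)"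
    (is "_ \<le> ?B * _")
proof -
  \<comment> \<open>The Taylor sum runs up to \<open>n\<close> inclusive and its error involves
    derivative \<open>n + 1\<close> of \<open>dpow m\<close>, which is
    \<open>dpow K\<close>.\<close>
  define n where "n = K - m - 1"
  have n: "Suc n = K - m" "m + Suc n = K" using m by (auto simp: n_def)
  have "norm (dpow (m + 0) s (x + v) - (\<Sum>i\<le>n. dpow (m + i) s x * (x + v - x) ^ i / fact i)) \<le>
    ?B * norm (x + v - x) ^ Suc n / fact n"
  proof (rule complex_Taylor[where f = "\<lambda>i. dpow (m + i) s"])
    show "convex {y. ht y \<ge> ht x}" by (rule convex_half_height)
    fix y assume y: "y \<in> {y. ht y \<ge> ht x}"
    have yH: "y \<in> H" using y x by (simp add: mem_H)
    show "(dpow (m + i) s has_field_derivative dpow (m + Suc i) s y) (at y within {y. ht x \<le> ht y})" for i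
      using dpow_has_field_derivative[OF yH, of "m + i" s] by (simp add: has_field_derivative_at_within)
    show "norm (dpow (m + Suc n) s y) \<le> ?B"
      unfolding n(2) using x y s by (intro dpow_bound) (auto simp: mem_H)
  qed (use v in \<open>auto simp: half_height_add\<close>)
  also have "\<dots> \<le> ?B * norm v ^ (K - m)"
  proof -
    have "?B * norm v ^ (K - m) \<ge> 0" by simp
    then have "?B * norm v ^ (K - m) / fact n \<le> ?B * norm v ^ (K - m) / 1"
      by (intro divide_left_mono fact_ge_1) auto
    then show ?thesis by (simp add: n)
  qed
  finally show ?thesis
    by (simp add: n(1)[symmetric] lessThan_Suc_atMost)
qed

text \<open>The truncation error, kept multiplied by \<open>\<Prod>\<^sub>j (j - \<alpha>)\<close>, which makes it entire in \<open>\<alpha>\<close>.\<close>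

definition err :: "nat \<Rightarrow> complex \<Rightarrow> complex \<Rightarrow> complex" where
  "err M \<alpha> x = dpow d (of_nat d - \<alpha>) x
     - (\<Sum>m<M. todd m * G_op d (\<lambda>y. dpow m (of_nat d - \<alpha>) (x + y)) w)"

text \<open>For \<open>M = 0\<close> nothing is subtracted and \<open>err\<close> is
  \<open>dpow d\<close> itself, hence the value 1. Otherwise the sum collects the Taylor remainders
  at all subset sums.\<close>

definition err_const :: "nat \<Rightarrow> real" where
  "err_const M = (if M = 0 then 1 else
     (\<Sum>m<M. norm (todd m) * (\<Sum>S\<in>Pow {1..d}. norm (wsum S) ^ (M + d - m))))"

lemma err_const_nonneg: "err_const M \<ge> 0"
  by (auto simp: err_const_def intro!: sum_nonneg mult_nonneg_nonneg)

lemma ht_wsum_nonneg: "S \<subseteq> {1..d} \<Longrightarrow> ht (wsum S) \<ge> 0"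
  unfolding half_height_sum using w by (intro sum_nonneg) (auto simp: mem_H less_imp_le)

lemma G_op_norm_le:
  "norm (G_op d g v) \<le> (\<Sum>S\<in>Pow {1..d}. norm (g (\<Sum>i\<in>S. v i)))"
  unfolding G_op_def by (rule order_trans[OF norm_sum]) (simp add: norm_mult norm_power)

text \<open>Expand every \<open>dpow m\<close> to total order \<open>K = M + d\<close> and regroup
  by the order \<open>j = m + i\<close>. The convolution identity leaves only \<open>j = d\<close>,
  which cancels the leading term of \<open>err\<close>; only Taylor remainders survive.\<close>

lemma err_bound:
  assumes x: "x \<in> H" and \<alpha>: "Re \<alpha> + real M \<ge> 0"
  shows "norm (err M \<alpha> x) \<le> err_const M *
    (norm (falling (M + d) (of_nat d - \<alpha>)) * (exp (im_bound * \<bar>Im \<alpha>\<bar>) * ht x powr (- (Re \<alpha> + real M))))"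
proof -
  define s where "s = of_nat d - \<alpha>"
  define K where "K = M + d"
  define B where "B = norm (falling K s) * (exp (im_bound * \<bar>Im s\<bar>) * ht x powr (Re s - real K))"
  have Res: "Re s - real K = - (Re \<alpha> + real M)" "\<bar>Im s\<bar> = \<bar>Im \<alpha>\<bar>" by (simp_all add: s_def K_def)
  have sK: "Re s \<le> real K" using Res \<alpha> by simp
  have "norm (err M \<alpha> x) \<le> err_const M * B"
  \<comment> \<open>For \<open>M = 0\<close> the order \<open>d\<close> is not below
    \<open>K\<close>, so no cancellation is available and \<open>dpow d\<close> is estimated
    directly.\<close>
  proof (cases "M = 0")
    case True
    then show ?thesis
      using dpow_bound[of "ht x" x s d] x sK
      by (simp add: err_def err_const_def B_def s_def K_def mem_H)
  next
    case False
    define R where "R = (\<lambda>m y. dpow m s (x + y) - (\<Sum>i<K - m. dpow (m + i) s x * (y ^ i / fact i)))"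
    define e where "e = (\<lambda>k. G_op d (\<lambda>y. y ^ k / fact k) w)"
    have split: "G_op d (\<lambda>y. dpow m s (x + y)) w = (\<Sum>i<K - m. dpow (m + i) s x * e i) + G_op d (R m) w" for m
    proof -
      have "(\<lambda>y. dpow m s (x + y)) = (\<lambda>y. (\<Sum>i<K - m. dpow (m + i) s x * (y ^ i / fact i)) + R m y)"
        by (simp add: R_def)
      then show ?thesis by (simp only: G_op_add G_op_sum G_op_cmult e_def)
    qed
    have "(\<Sum>m<M. todd m * (\<Sum>i<K - m. dpow (m + i) s x * e i)) =
        (\<Sum>m<M. \<Sum>j\<in>{j\<in>{..<K}. m \<le> j}. dpow j s x * (todd m * e (j - m)))"
    proof (rule sum.cong[OF refl])
      fix m assume "m \<in> {..<M}"
      have "todd m * (\<Sum>i<K - m. dpow (m + i) s x * e i) =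
          (\<Sum>i<K - m. dpow (m + i) s x * (todd m * e i))"
        by (simp add: sum_distrib_left mult_ac)
      also have "\<dots> = (\<Sum>j\<in>{j\<in>{..<K}. m \<le> j}. dpow j s x * (todd m * e (j - m)))"
        by (rule sum.reindex_bij_witness[of _ "\<lambda>j. j - m" "\<lambda>i. m + i"]) auto
      finally show "todd m * (\<Sum>i<K - m. dpow (m + i) s x * e i) = \<dots>" .
    qed
    \<comment> \<open>Interchanging the sums collects all contributions to one derivative order
      \<open>j\<close>.\<close>
    also have "\<dots> = (\<Sum>j<K. \<Sum>m\<in>{m\<in>{..<M}. m \<le> j}. dpow j s x * (todd m * e (j - m)))"
      by (rule sum.swap_restrict) auto
    also have "\<dots> = (\<Sum>j<K. dpow j s x * (if j = d then 1 else 0))"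
    proof (rule sum.cong[OF refl])
      fix j assume "j \<in> {..<K}"
      then have "(\<Sum>m\<in>{m. m < M \<and> m \<le> j}. todd m * e (j - m)) = (if j = d then 1 else 0)"
        unfolding e_def by (intro todd_coeff_G_op_convolution w_neq_0) (auto simp: K_def)
      then show "(\<Sum>m\<in>{m\<in>{..<M}. m \<le> j}. dpow j s x * (todd m * e (j - m))) =
          dpow j s x * (if j = d then 1 else 0)"
        by (simp only: sum_distrib_left[symmetric] lessThan_iff)
    qed
    also have "\<dots> = dpow d s x"
      using False by (simp add: K_def if_distrib cong: if_cong)
    finally have main: "(\<Sum>m<M. todd m * (\<Sum>i<K - m. dpow (m + i) s x * e i)) = dpow d s x" .
    have "err M \<alpha> x = dpow d s x - (\<Sum>m<M. todd m * ((\<Sum>i<K - m. dpow (m + i) s x * e i) + G_op d (R m) w))"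
      by (simp only: err_def split flip: s_def)
    also have "\<dots> = - (\<Sum>m<M. todd m * G_op d (R m) w)"
      by (simp only: distrib_left sum.distrib main) simp
    finally have "norm (err M \<alpha> x) \<le> (\<Sum>m<M. norm (todd m * G_op d (R m) w))"
      by (simp add: norm_sum)
    also have "\<dots> \<le> (\<Sum>m<M. norm (todd m) * (B * (\<Sum>S\<in>Pow {1..d}. norm (wsum S) ^ (K - m))))"
      unfolding norm_mult
    proof (intro sum_mono mult_left_mono norm_ge_zero)
      fix m assume m: "m \<in> {..<M}"
      have "norm (G_op d (R m) w) \<le> (\<Sum>S\<in>Pow {1..d}. norm (R m (wsum S)))"
        by (rule G_op_norm_le)
      also have "\<dots> \<le> (\<Sum>S\<in>Pow {1..d}. B * norm (wsum S) ^ (K - m))"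
        unfolding R_def B_def using m by (intro sum_mono dpow_taylor x sK ht_wsum_nonneg) (auto simp: K_def)
      finally show "norm (G_op d (R m) w) \<le> B * (\<Sum>S\<in>Pow {1..d}. norm (wsum S) ^ (K - m))"
        by (simp add: sum_distrib_left)
    qed
    also have "\<dots> = err_const M * B"
      using False by (simp add: err_const_def K_def sum_distrib_right sum_distrib_left mult_ac)
    finally show ?thesis .
  qed
  then show ?thesis unfolding B_def Res by (simp add: s_def K_def)
qed

section \<open>Lattice points and locally uniform summability of the error\<close>

lemma ht_node_lower:
  obtains c where "c > 0" "\<And>n. ht (node n) \<ge> c * (1 + (\<Sum>i=1..d. real (n i)))"
proof -
  \<comment> \<open>The smallest height among \<open>a\<close> and the \<open>w i\<close>: the
    height of a lattice point then grows at least linearly in the sum of its coordinates.\<close>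
  define c where "c = Min (insert (ht a) ((\<lambda>i. ht (w i)) ` {1..d}))"
  have pos: "c > 0" unfolding c_def using a w by (subst Min_gr_iff) (auto simp: mem_H)
  have ca: "c \<le> ht a" unfolding c_def by (intro Min_le) auto
  have cw: "c \<le> ht (w i)" if "i \<in> {1..d}" for i unfolding c_def using that by (intro Min_le) auto
  have "ht (node n) \<ge> c * (1 + (\<Sum>i=1..d. real (n i)))" for n
  proof -
    have "c * (1 + (\<Sum>i=1..d. real (n i))) = c + (\<Sum>i=1..d. real (n i) * c)"
      by (simp add: distrib_left sum_distrib_left mult_ac)
    also have "\<dots> \<le> ht a + (\<Sum>i=1..d. real (n i) * ht (w i))"
      using ca cw by (intro add_mono sum_mono mult_left_mono) auto
    also have "\<dots> = ht (node n)"
      by (simp add: half_height_add ndot_def half_height_sum half_height_of_nat)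
    finally show ?thesis .
  qed
  with pos that show ?thesis by blast
qed

lemma node_H: "node n \<in> H"
proof -
  obtain c where c: "c > 0" "\<And>n. ht (node n) \<ge> c * (1 + (\<Sum>i=1..d. real (n i)))" by (rule ht_node_lower) blast
  have "c * (1 + (\<Sum>i=1..d. real (n i))) > 0" using c(1) by (simp add: add_pos_nonneg sum_nonneg)
  with c(2)[of n] show ?thesis by (simp add: mem_H)
qed

lemma add_wsum_H: "x \<in> H \<Longrightarrow> S \<subseteq> {1..d} \<Longrightarrow> x + wsum S \<in> H"
  using ht_wsum_nonneg[of S] by (simp add: mem_H half_height_add)

lemma dpow_holomorphic: "(\<lambda>\<alpha>. dpow k (of_nat d - \<alpha>) x) holomorphic_on A"
  unfolding dpow_def falling_def by (intro holomorphic_intros)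

lemma err_holomorphic: "(\<lambda>\<alpha>. err M \<alpha> x) holomorphic_on A"
  unfolding err_def G_op_def by (intro holomorphic_intros dpow_holomorphic)

lemma err_locally_dominated:
  assumes z: "Re z > real d - real M"
  obtains r B where "r > 0" "B summable_on nat_vecs d"
    "\<And>n \<alpha>. \<alpha> \<in> cball z r \<Longrightarrow> norm (err M \<alpha> (node n)) \<le> B n"
proof -
  \<comment> \<open>Half the distance to the line \<open>Re z = d - M\<close>: throughout the ball
    the decay exponent \<open>Re \<alpha> + M\<close> still exceeds \<open>d\<close> by at least
    \<open>r\<close>.\<close>
  define r where "r = (Re z + real M - real d) / 2"
  have r: "r > 0" using z by (simp add: r_def)
  obtain c where c: "c > 0" "\<And>n. ht (node n) \<ge> c * (1 + (\<Sum>i=1..d. real (n i)))" by (rule ht_node_lower) blast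
  define X where "X = (\<lambda>n::nat \<Rightarrow> nat. 1 + (\<Sum>i=1..d. real (n i)))"
  have X1: "X n \<ge> 1" for n by (simp add: X_def sum_nonneg)
  \<comment> \<open>All factors that depend on \<open>\<alpha>\<close> but not on \<open>n\<close>;
    continuity on the compact ball bounds them uniformly.\<close>
  define \<Phi> where "\<Phi> = (\<lambda>\<alpha>. norm (falling (M + d) (of_nat d - \<alpha>)) *
     (exp (im_bound * \<bar>Im \<alpha>\<bar>) * c powr (- (Re \<alpha> + real M))))"
  have "continuous_on (cball z r) \<Phi>"
    unfolding \<Phi>_def falling_def using c(1) by (intro continuous_intros) auto
  then have "bounded (\<Phi> ` cball z r)"
    by (intro compact_imp_bounded compact_continuous_image) auto
  then obtain b where b: "\<And>\<alpha>. \<alpha> \<in> cball z r \<Longrightarrow> \<Phi> \<alpha> \<le> b"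
    unfolding bounded_iff by (metis abs_le_D1 imageI real_norm_def)
  have "norm (err M \<alpha> (node n)) \<le> err_const M * (b * X n powr (- (real d + r)))"
    if \<alpha>: "\<alpha> \<in> cball z r" for \<alpha> n
  proof -
    have "\<bar>Re z - Re \<alpha>\<bar> \<le> r"
      using \<alpha> abs_Re_le_cmod[of "z - \<alpha>"] by (simp add: dist_norm)
    moreover have "2 * r = Re z + real M - real d" by (simp add: r_def)
    ultimately have ge: "Re \<alpha> + real M \<ge> real d + r" by linarith
    have cX: "c * X n > 0" using c(1) X1[of n] by simp
    have "ht (node n) powr (- (Re \<alpha> + real M)) \<le> (c * X n) powr (- (Re \<alpha> + real M))"
      using c(2)[of n] cX ge r by (intro powr_mono2') (auto simp: X_def)
    also have "\<dots> = c powr (- (Re \<alpha> + real M)) * X n powr (- (Re \<alpha> + real M))"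
      using c(1) X1[of n] by (simp add: powr_mult)
    also have "\<dots> \<le> c powr (- (Re \<alpha> + real M)) * X n powr (- (real d + r))"
      using ge X1[of n] by (intro mult_left_mono powr_mono) auto
    finally have h: "ht (node n) powr (- (Re \<alpha> + real M)) \<le> c powr (- (Re \<alpha> + real M)) * X n powr (- (real d + r))" .
    have "norm (err M \<alpha> (node n)) \<le> err_const M *
      (norm (falling (M + d) (of_nat d - \<alpha>)) * (exp (im_bound * \<bar>Im \<alpha>\<bar>) * ht (node n) powr (- (Re \<alpha> + real M))))"
      using ge r by (intro err_bound node_H) auto
    also have "\<dots> \<le> err_const M *
      (norm (falling (M + d) (of_nat d - \<alpha>)) * (exp (im_bound * \<bar>Im \<alpha>\<bar>) *
        (c powr (- (Re \<alpha> + real M)) * X n powr (- (real d + r)))))"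
      by (intro mult_left_mono h err_const_nonneg) auto
    also have "\<dots> = err_const M * (\<Phi> \<alpha> * X n powr (- (real d + r)))"
      by (simp add: \<Phi>_def mult_ac)
    also have "\<dots> \<le> err_const M * (b * X n powr (- (real d + r)))"
      by (intro mult_left_mono mult_right_mono b \<alpha> err_const_nonneg) auto
    finally show ?thesis .
  qed
  moreover have "(\<lambda>n. err_const M * (b * X n powr (- (real d + r)))) summable_on nat_vecs d"
    unfolding X_def using d r by (intro summable_on_cmult_right summable_on_nat_vecs_powr) auto
  ultimately show ?thesis using r that by blast
qed

lemma err_summable:
  assumes "Re z > real d - real M"
  shows "(\<lambda>n. err M z (node n)) summable_on nat_vecs d"
proof -
  obtain r B where *: "r > 0" "B summable_on nat_vecs d"
    "\<And>n \<alpha>. \<alpha> \<in> cball z r \<Longrightarrow> norm (err M \<alpha> (node n)) \<le> B n"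
    using err_locally_dominated[OF assms] by blast
  have "(\<lambda>n. norm (err M z (node n))) summable_on nat_vecs d"
    by (rule summable_on_comparison_test[OF *(2)]) (use *(1,3) in auto)
  then show ?thesis by (rule abs_summable_summable)
qed

lemma err_infsum_has_field_derivative:
  assumes z: "Re z > real d - real M"
  obtains D where "((\<lambda>\<alpha>. \<Sum>\<^sub>\<infinity>n\<in>nat_vecs d. err M \<alpha> (node n)) has_field_derivative D) (at z)"
    "((\<lambda>n. deriv (\<lambda>\<alpha>. err M \<alpha> (node n)) z) has_sum D) (nat_vecs d)"
proof -
  obtain r B where r: "r > 0" and B: "B summable_on nat_vecs d"
    and bd: "\<And>n \<alpha>. \<alpha> \<in> cball z r \<Longrightarrow> norm (err M \<alpha> (node n)) \<le> B n"
    using err_locally_dominated[OF z] by blast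
  show ?thesis
  proof (rule infsum_has_field_derivative[of "nat_vecs d" "\<lambda>n \<alpha>. err M \<alpha> (node n)" z r B])
    show "continuous_on (cball z r) (\<lambda>\<alpha>. err M \<alpha> (node n))" for n
      by (intro holomorphic_on_imp_continuous_on err_holomorphic)
  qed (use r B bd that err_holomorphic in auto)
qed

text \<open>The error sum with the subtracted differences restored: each of them telescopes over the
  lattice to \<open>(-1) ^ d\<close> times its value at \<open>a\<close>. This is the numerator of
  the continuation on \<open>Re \<alpha> > d - M\<close>.\<close>

definition num :: "nat \<Rightarrow> complex \<Rightarrow> complex" where
  "num M \<alpha> = (\<Sum>\<^sub>\<infinity>n\<in>nat_vecs d. err M \<alpha> (node n)) + (-1) ^ d * (\<Sum>m<M. todd m * dpow m (of_nat d - \<alpha>) a)"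

lemma num_holomorphic: "num M holomorphic_on {z. Re z > real d - real M}"
proof -
  have "(\<lambda>\<alpha>. \<Sum>\<^sub>\<infinity>n\<in>nat_vecs d. err M \<alpha> (node n)) holomorphic_on {z. Re z > real d - real M}"
  proof (subst holomorphic_on_open)
    show "open {z. real d - real M < Re z}" by (rule open_halfspace_Re_gt)
    show "\<forall>x\<in>{z. real d - real M < Re z}.
       \<exists>f'. ((\<lambda>\<alpha>. \<Sum>\<^sub>\<infinity>n\<in>nat_vecs d. err M \<alpha> (node n)) has_field_derivative f') (at x)"
      using err_infsum_has_field_derivative by blast
  qed
  then show ?thesis
    unfolding num_def by (intro holomorphic_intros dpow_holomorphic)
qed

end

section \<open>Telescoping over the lattice and independence of the truncation order\<close>

lemma has_sum_finite_sum:
  fixes f :: "'i \<Rightarrow> 'a \<Rightarrow> 'b :: topological_comm_monoid_add"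
  assumes "finite I" "\<And>i. i \<in> I \<Longrightarrow> (f i has_sum s i) A"
  shows "((\<lambda>x. \<Sum>i\<in>I. f i x) has_sum (\<Sum>i\<in>I. s i)) A"
  using assms by (induction I rule: finite_induct) (auto intro: has_sum_add)

text \<open>The sum is the expansion of a nonempty product of factors
  \<open>(-1) + 1\<close>.\<close>

lemma sum_Pow_alternating:
  assumes A: "finite A" "A \<noteq> {}"
  shows "(\<Sum>S\<in>Pow A. (-1) ^ card S) = (0 :: 'a :: comm_ring_1)"
proof -
  have "(\<Sum>S\<in>Pow A. (-1) ^ card S) = (\<Sum>S\<in>Pow A. (\<Prod>i\<in>S. -1) * (\<Prod>i\<in>A - S. 1 :: 'a))"
    by simp
  also have "\<dots> = (\<Prod>i\<in>A. (-1) + 1)"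
    using A(1) by (rule prod_add[symmetric])
  also have "\<dots> = 0"
    using A by (simp add: zero_power card_gt_0_iff)
  finally show ?thesis .
qed

context barnes
begin

lemma node_shift:
  assumes "S \<subseteq> {1..d}"
  shows "node (\<lambda>i\<in>{1..d}. n i + (if i \<in> S then 1 else 0)) = node n + wsum S"
proof -
  have "ndot d (\<lambda>i\<in>{1..d}. n i + (if i \<in> S then 1 else 0)) w = (\<Sum>i=1..d. of_nat (n i) * w i + (if i \<in> S then w i else 0))"
    unfolding ndot_def by (rule sum.cong) (auto simp: algebra_simps)
  also have "\<dots> = ndot d n w + (\<Sum>i\<in>{1..d} \<inter> S. w i)"
    by (simp add: sum.distrib ndot_def sum.inter_restrict)
  also have "{1..d} \<inter> S = S" using assms by blast
  finally show ?thesis by (simp only: add.assoc)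
qed

text \<open>Shifting by the \<open>w i\<close> with \<open>i \<in> S\<close> turns the sum into one
  over the points with \<open>n i \<ge> 1\<close> on \<open>S\<close>. By inclusion-exclusion the
  signed contributions at a fixed point cancel unless all its coordinates vanish.\<close>

lemma G_op_telescope:
  assumes f: "(\<lambda>n. f (node n)) summable_on nat_vecs d"
  shows "((\<lambda>n. G_op d (\<lambda>y. f (node n + y)) w) has_sum ((-1) ^ d * f a)) (nat_vecs d)"
proof -
  define V where "V = (\<lambda>S. {n \<in> nat_vecs d. \<forall>i\<in>S. n i \<ge> 1})"
  define T where "T = (\<lambda>S. \<Sum>\<^sub>\<infinity>n\<in>V S. f (node n))"
  \<comment> \<open>Extension by zero puts the sums over the various \<open>V S\<close> on one index
    set, so that they can be combined pointwise.\<close>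
  define h where "h = (\<lambda>S n. if \<forall>i\<in>S. n i \<ge> 1 then f (node n) else 0)"
  have Vsum: "((\<lambda>n. f (node n)) has_sum T S) (V S)" for S
    unfolding T_def by (intro has_sum_infsum summable_on_subset_banach[OF f]) (auto simp: V_def)
  have h: "(h S has_sum T S) (nat_vecs d)" for S
    using Vsum by (rule has_sum_cong_neutral[THEN iffD1, rotated -1]) (auto simp: V_def h_def)
  have shift: "((\<lambda>n. f (node n + wsum S)) has_sum T S) (nat_vecs d)" if S: "S \<subseteq> {1..d}" for S
  proof -
    \<comment> \<open>The inverse subtracts the indicator of \<open>S\<close>; natural subtraction
      is exact here because \<open>n i \<ge> 1\<close> on \<open>S\<close> for
      \<open>n \<in> V S\<close>.\<close>
    have "bij_betw (\<lambda>n. \<lambda>i\<in>{1..d}. n i + (if i \<in> S then 1 else 0)) (nat_vecs d) (V S)"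
      by (rule bij_betw_byWitness[where f' = "\<lambda>n. \<lambda>i\<in>{1..d}. n i - (if i \<in> S then 1 else 0)"])
        (use S in \<open>auto simp: nat_vecs_def V_def fun_eq_iff PiE_def extensional_def restrict_def\<close>)
    from has_sum_reindex_bij_betw[OF this, of "\<lambda>n. f (node n)" "T S"] Vsum[of S]
    show ?thesis by (simp only: node_shift[OF S])
  qed
  have G: "((\<lambda>n. G_op d (\<lambda>y. f (node n + y)) w) has_sum (\<Sum>S\<in>Pow {1..d}. (-1) ^ (d - card S) * T S)) (nat_vecs d)"
    unfolding G_op_def by (intro has_sum_finite_sum has_sum_cmult_right shift) auto
  have K: "((\<lambda>n. \<Sum>S\<in>Pow {1..d}. (-1) ^ (d - card S) * h S n) has_sum (\<Sum>S\<in>Pow {1..d}. (-1) ^ (d - card S) * T S)) (nat_vecs d)"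
    by (intro has_sum_finite_sum has_sum_cmult_right h) auto
  define n0 :: "nat \<Rightarrow> nat" where "n0 = (\<lambda>i\<in>{1..d}. 0)"
  have n0: "n0 \<in> nat_vecs d" "node n0 = a" by (auto simp: n0_def nat_vecs_def ndot_def)
  have val: "(\<Sum>S\<in>Pow {1..d}. (-1) ^ (d - card S) * h S n) = (if n = n0 then (-1) ^ d * f a else 0)"
    if n: "n \<in> nat_vecs d" for n
  proof -
    \<comment> \<open>Only subsets of the set of positive coordinates contribute at
      \<open>n\<close>.\<close>
    define A where "A = {i\<in>{1..d}. n i \<ge> 1}"
    have "(\<Sum>S\<in>Pow {1..d}. (-1) ^ (d - card S) * h S n) = (\<Sum>S\<in>Pow A. (-1) ^ (d - card S) * f (node n))"
      by (rule sum.mono_neutral_cong_right) (auto simp: A_def h_def)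
    also have "\<dots> = (\<Sum>S\<in>Pow A. (-1) ^ d * f (node n) * (-1) ^ card S)"
    proof (rule sum.cong[OF refl])
      fix S assume "S \<in> Pow A"
      then have "card S \<le> card {1..d}" by (intro card_mono) (auto simp: A_def)
      then have "d = (d - card S) + card S" by simp
      then have "(-1) ^ d * (-1) ^ card S = (-1 :: complex) ^ (d - card S) * ((-1) ^ card S * (-1) ^ card S)"
        by (metis mult.assoc power_add)
      also have "\<dots> = (-1) ^ (d - card S)" by (simp flip: power_mult_distrib)
      finally show "(-1) ^ (d - card S) * f (node n) = (-1) ^ d * f (node n) * (-1) ^ card S"
        by (metis mult.commute mult.left_commute)
    qed
    also have "\<dots> = (-1) ^ d * f (node n) * (\<Sum>S\<in>Pow A. (-1) ^ card S)"
      by (rule sum_distrib_left[symmetric])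
    also have "\<dots> = (if n = n0 then (-1) ^ d * f a else 0)"
    proof (cases "A = {}")
      case True
      then have "n = n0" using n by (fastforce simp: A_def n0_def nat_vecs_def PiE_def extensional_def)
      with True n0 show ?thesis by simp
    next
      case False
      then have "n \<noteq> n0" by (auto simp: A_def n0_def)
      with False show ?thesis by (simp add: sum_Pow_alternating A_def)
    qed
    finally show ?thesis .
  qed
  have "((\<lambda>n. if n = n0 then (-1) ^ d * f a else 0) has_sum ((-1) ^ d * f a)) (nat_vecs d)"
    by (rule has_sum_finite_neutralI[of "{n0}"]) (use n0 in auto)
  then have "((\<lambda>n. \<Sum>S\<in>Pow {1..d}. (-1) ^ (d - card S) * h S n) has_sum ((-1) ^ d * f a)) (nat_vecs d)"
    by (subst has_sum_cong[OF val])
  from has_sum_unique[OF this K] G show ?thesis by simp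
qed

lemma dpow_node_summable:
  assumes s: "Re s < real k - real d"
  shows "(\<lambda>n. dpow k s (node n)) summable_on nat_vecs d"
proof -
  obtain c where c: "c > 0" "\<And>n. ht (node n) \<ge> c * (1 + (\<Sum>i=1..d. real (n i)))" by (rule ht_node_lower) blast
  define X where "X = (\<lambda>n::nat \<Rightarrow> nat. 1 + (\<Sum>i=1..d. real (n i)))"
  have X1: "X n \<ge> 1" for n by (simp add: X_def sum_nonneg)
  define b where "b = norm (falling k s) * (exp (im_bound * \<bar>Im s\<bar>) * c powr (Re s - real k))"
  have "(\<lambda>n. norm (dpow k s (node n))) summable_on nat_vecs d"
  proof (rule summable_on_comparison_test)
    show "(\<lambda>n. b * X n powr (- (real k - Re s))) summable_on nat_vecs d"
      unfolding X_def using d s by (intro summable_on_cmult_right summable_on_nat_vecs_powr) auto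
    fix n
    have "norm (dpow k s (node n)) \<le>
      norm (falling k s) * (exp (im_bound * \<bar>Im s\<bar>) * (c * X n) powr (Re s - real k))"
      using c X1[of n] s by (intro dpow_bound) (auto simp: X_def)
    also have "\<dots> = b * X n powr (- (real k - Re s))"
      using c(1) X1[of n] by (simp add: powr_mult b_def mult_ac)
    finally show "norm (dpow k s (node n)) \<le> b * X n powr (- (real k - Re s))" .
  qed auto
  then show ?thesis by (rule abs_summable_summable)
qed

text \<open>Beyond \<open>2 d\<close>, and not just \<open>d\<close>, each \<open>dpow m (d - \<alpha>)\<close> is itself summable over the lattice, so that
  telescoping may be applied to it separately.\<close>

lemma num_eq_num_0:
  assumes \<alpha>: "Re \<alpha> > 2 * real d"
  shows "num M \<alpha> = num 0 \<alpha>"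
proof -
  let ?s = "of_nat d - \<alpha>"
  have tel: "((\<lambda>n. \<Sum>m<M. todd m * G_op d (\<lambda>y. dpow m ?s (node n + y)) w) has_sum
      (\<Sum>m<M. todd m * ((-1) ^ d * dpow m ?s a))) (nat_vecs d)"
    using \<alpha> by (intro has_sum_finite_sum has_sum_cmult_right G_op_telescope dpow_node_summable) auto
  have "((\<lambda>n. err M \<alpha> (node n)) has_sum (\<Sum>\<^sub>\<infinity>n\<in>nat_vecs d. err M \<alpha> (node n))) (nat_vecs d)"
    using \<alpha> by (intro has_sum_infsum err_summable) auto
  from has_sum_add[OF this tel]
  have "((\<lambda>n. err 0 \<alpha> (node n)) has_sum ((\<Sum>\<^sub>\<infinity>n\<in>nat_vecs d. err M \<alpha> (node n)) +
      (\<Sum>m<M. todd m * ((-1) ^ d * dpow m ?s a)))) (nat_vecs d)"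
    by (simp add: err_def)
  then have "(\<Sum>\<^sub>\<infinity>n\<in>nat_vecs d. err 0 \<alpha> (node n)) =
      (\<Sum>\<^sub>\<infinity>n\<in>nat_vecs d. err M \<alpha> (node n)) + (\<Sum>m<M. todd m * ((-1) ^ d * dpow m ?s a))"
    by (rule infsumI)
  then show ?thesis
    by (simp add: num_def sum_distrib_left mult_ac)
qed

text \<open>Both sides agree on a far right half-plane, and the identity theorem carries this to the
  connected half-plane where both are holomorphic.\<close>

lemma num_eq:
  assumes "Re \<alpha> > real d - real M" "Re \<alpha> > real d - real M'"
  shows "num M \<alpha> = num M' \<alpha>"
proof (rule analytic_continuation_open[where f = "num M" and g = "num M'"])
  define c where "c = max (real d - real M) (real d - real M')"
  show "open {z. Re z > 2 * real d}" "open {z. Re z > c}" by (rule open_halfspace_Re_gt)+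
  show "connected {z. Re z > c}" by (intro convex_connected convex_halfspace_Re_gt)
  have "complex_of_real (2 * real d + 1) \<in> {z. Re z > 2 * real d}" by simp
  then show "{z. Re z > 2 * real d} \<noteq> {}" by blast
  show "{z. Re z > 2 * real d} \<subseteq> {z. Re z > c}" by (auto simp: c_def)
  show "num M holomorphic_on {z. Re z > c}" "num M' holomorphic_on {z. Re z > c}"
    by (rule holomorphic_on_subset[OF num_holomorphic]; auto simp: c_def)+
  show "num M z = num M' z" if "z \<in> {z. Re z > 2 * real d}" for z
    using that num_eq_num_0[of z M] num_eq_num_0[of z M'] by simp
  show "\<alpha> \<in> {z. Re z > c}" using assms by (simp add: c_def)
qed

section \<open>The entire numerator and the continuation as a quotient\<close>

definition zeta_num :: "complex \<Rightarrow> complex" where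
  "zeta_num \<alpha> = num (nat \<lceil>real d - Re \<alpha>\<rceil> + 1) \<alpha>"

lemma zeta_num_eq:
  assumes "Re \<alpha> > real d - real M" shows "zeta_num \<alpha> = num M \<alpha>"
proof -
  \<comment> \<open>The \<open>+ 1\<close> makes the inequality strict, also when the ceiling is
    negative and \<open>nat\<close> truncates it to 0.\<close>
  have "real (nat \<lceil>real d - Re \<alpha>\<rceil> + 1) > real d - Re \<alpha>" by linarith
  then show ?thesis unfolding zeta_num_def using assms by (intro num_eq) auto
qed

text \<open>Near a given point one fixed \<open>M\<close> represents \<open>zeta_num\<close>, so the
  jumps of the ceiling in its definition have no effect.\<close>

lemma zeta_num_holomorphic: "zeta_num holomorphic_on UNIV"
proof -
  have "zeta_num analytic_on {z}" for z
  proof -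
    define M where "M = nat \<lceil>real d - Re z\<rceil> + 1"
    have z: "Re z > real d - real M" unfolding M_def by linarith
    have "zeta_num holomorphic_on {z. Re z > real d - real M}"
      using num_holomorphic[of M] by (rule holomorphic_transform) (simp add: zeta_num_eq)
    then show ?thesis
      using z open_halfspace_Re_gt[of "real d - real M"] analytic_at by blast
  qed
  then have "zeta_num analytic_on UNIV" using analytic_on_analytic_at by blast
  then show ?thesis by (rule analytic_imp_holomorphic)
qed

definition zeta_den :: "complex \<Rightarrow> complex" where
  "zeta_den \<alpha> = falling d (of_nat d - \<alpha>)"

lemma zeta_den_eq: "zeta_den \<alpha> = (\<Prod>j\<in>{1..d}. of_nat j - \<alpha>)"
  unfolding zeta_den_def falling_def
  by (rule prod.reindex_bij_witness[of _ "\<lambda>j. d - j" "\<lambda>i. d - i"]) (auto simp: of_nat_diff)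

lemma zeta_den_eq_0_iff: "zeta_den \<alpha> = 0 \<longleftrightarrow> \<alpha> \<in> of_nat ` {1..d}"
  unfolding zeta_den_eq by (auto simp: prod_zero_iff)

lemma zeta_den_holomorphic: "zeta_den holomorphic_on A"
  unfolding zeta_den_eq[abs_def] by (intro holomorphic_intros)

text \<open>In this range \<open>M = 0\<close> is admissible, and \<open>err 0\<close> is
  \<open>zeta_den\<close> times the term of the series.\<close>

lemma zeta_num_series:
  assumes "Re \<alpha> > real d"
  shows "zeta_num \<alpha> = zeta_den \<alpha> * barnes_series L d a w \<alpha>"
proof -
  have "zeta_num \<alpha> = num 0 \<alpha>" using assms by (intro zeta_num_eq) auto
  also have "\<dots> = (\<Sum>\<^sub>\<infinity>n\<in>nat_vecs d. zeta_den \<alpha> * exp (- \<alpha> * L (node n)))"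
    by (simp add: num_def err_def dpow_def zeta_den_def)
  also have "\<dots> = zeta_den \<alpha> * barnes_series L d a w \<alpha>"
    unfolding barnes_series_def by (rule infsum_cmult_right') 
  finally show ?thesis .
qed

lemma barnes_zeta_eq: "barnes_zeta L d a w = remove_sings (\<lambda>\<alpha>. zeta_num \<alpha> / zeta_den \<alpha>)"
proof -
  let ?F = "\<lambda>\<alpha>. zeta_num \<alpha> / zeta_den \<alpha>"
  let ?Z = "remove_sings ?F"
  have an: "zeta_num analytic_on A" and ad: "zeta_den analytic_on A" for A
    using zeta_num_holomorphic zeta_den_holomorphic analytic_on_open[OF open_UNIV] analytic_on_subset by blast+
  have "?F meromorphic_on UNIV"
    using an ad by (intro meromorphic_intros analytic_on_imp_meromorphic_on)
  then have nice: "?Z nicely_meromorphic_on UNIV" by (rule remove_sings_nicely_meromorphic)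
  have eq: "?Z \<alpha> = barnes_series L d a w \<alpha>" if \<alpha>: "Re \<alpha> > real d" for \<alpha>
  proof -
    have nz: "zeta_den \<alpha> \<noteq> 0" using \<alpha> by (auto simp: zeta_den_eq_0_iff)
    then have "?F analytic_on {\<alpha>}" by (intro analytic_intros an ad) auto
    then have "?Z \<alpha> = ?F \<alpha>" by (rule remove_sings_at_analytic)
    with nz zeta_num_series[OF \<alpha>] show ?thesis by simp
  qed
  show ?thesis
    unfolding barnes_zeta_def
  proof (rule the_equality)
    show "?Z nicely_meromorphic_on UNIV \<and> (\<forall>\<alpha>. real d < Re \<alpha> \<longrightarrow> ?Z \<alpha> = barnes_series L d a w \<alpha>)"
      using nice eq by blast
    fix Y assume Y: "Y nicely_meromorphic_on UNIV \<and> (\<forall>\<alpha>. real d < Re \<alpha> \<longrightarrow> Y \<alpha> = barnes_series L d a w \<alpha>)"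
    have "complex_of_real (real d + 1) \<in> {z. Re z > real d}" by simp
    then have "{z. Re z > real d} \<noteq> {}" by blast
    with Y nice eq show "Y = ?Z"
      by (intro nicely_meromorphic_eq_UNIV[OF _ _ open_halfspace_Re_gt[of "real d"]]) auto
  qed
qed

end

section \<open>The finite part\<close>

text \<open>Separating indices below and above \<open>q\<close> turns \<open>j - q\<close> into
  \<open>-i\<close> with \<open>i < q\<close> or into \<open>i \<le> k\<close>; this is where the
  harmonic numbers and factorials of \<open>q - 1\<close> and \<open>k\<close> come from.\<close>

lemma punctured_atLeastAtMost_split:
  assumes "q \<ge> 1"
  shows "{1..q + k} - {q} = (\<lambda>i. q - i) ` {1..<q} \<union> (\<lambda>i. q + i) ` {1..k :: nat}"
    "(\<lambda>i. q - i) ` {1..<q} \<inter> (\<lambda>i. q + i) ` {1..k} = {}"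
    "inj_on (\<lambda>i. q - i) {1..<q}"
proof -
  show "{1..q + k} - {q} = (\<lambda>i. q - i) ` {1..<q} \<union> (\<lambda>i. q + i) ` {1..k}"
  proof (intro set_eqI iffI)
    fix j assume j: "j \<in> {1..q + k} - {q}"
    show "j \<in> (\<lambda>i. q - i) ` {1..<q} \<union> (\<lambda>i. q + i) ` {1..k}"
    proof (cases "j < q")
      case True
      then show ?thesis using j by (intro UnI1 image_eqI[of _ _ "q - j"]) auto
    next
      case False
      then show ?thesis using j by (intro UnI2 image_eqI[of _ _ "j - q"]) auto
    qed
  qed (use assms in auto)
qed (auto simp: inj_on_def)

lemma sum_inverse_punctured:
  assumes "q \<ge> 1"
  shows "(\<Sum>j\<in>{1..q + k} - {q}. 1 / (of_nat j - of_nat q :: complex)) = harm k - harm (q - 1)"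
proof -
  have "(\<Sum>j\<in>{1..q + k} - {q}. 1 / (of_nat j - of_nat q :: complex)) =
      (\<Sum>j\<in>(\<lambda>i. q - i) ` {1..<q}. 1 / (of_nat j - of_nat q)) + (\<Sum>j\<in>(\<lambda>i. q + i) ` {1..k}. 1 / (of_nat j - of_nat q))"
    unfolding punctured_atLeastAtMost_split(1)[OF assms]
    by (rule sum.union_disjoint) (use punctured_atLeastAtMost_split(2)[OF assms] in auto)
  also have "\<dots> = (\<Sum>i\<in>{1..<q}. 1 / (of_nat (q - i) - of_nat q)) + (\<Sum>i\<in>{1..k}. 1 / (of_nat (q + i) - of_nat q))"
    by (subst (1 2) sum.reindex) (use punctured_atLeastAtMost_split(3)[OF assms] in \<open>auto simp: inj_on_def\<close>)
  also have "(\<Sum>i\<in>{1..<q}. 1 / (of_nat (q - i) - of_nat q :: complex)) = (\<Sum>i\<in>{1..q - 1}. - inverse (of_nat i))"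
    using assms by (intro sum.cong) (auto simp: of_nat_diff field_simps)
  also have "\<dots> = - harm (q - 1)" by (simp add: harm_def sum_negf)
  also have "(\<Sum>i\<in>{1..k}. 1 / (of_nat (q + i) - of_nat q :: complex)) = harm k"
    unfolding harm_def by (intro sum.cong) (auto simp: field_simps)
  finally show ?thesis by simp
qed

lemma prod_punctured:
  assumes "q \<ge> 1"
  shows "(\<Prod>j\<in>{1..q + k} - {q}. of_nat j - of_nat q :: complex) = (-1) ^ (q - 1) * fact (q - 1) * fact k"
proof -
  have "(\<Prod>j\<in>{1..q + k} - {q}. of_nat j - of_nat q :: complex) =
      (\<Prod>j\<in>(\<lambda>i. q - i) ` {1..<q}. of_nat j - of_nat q) * (\<Prod>j\<in>(\<lambda>i. q + i) ` {1..k}. of_nat j - of_nat q)"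
    unfolding punctured_atLeastAtMost_split(1)[OF assms]
    by (rule prod.union_disjoint) (use punctured_atLeastAtMost_split(2)[OF assms] in auto)
  also have "\<dots> = (\<Prod>i\<in>{1..<q}. of_nat (q - i) - of_nat q) * (\<Prod>i\<in>{1..k}. of_nat (q + i) - of_nat q)"
    by (subst (1 2) prod.reindex) (use punctured_atLeastAtMost_split(3)[OF assms] in \<open>auto simp: inj_on_def\<close>)
  also have "(\<Prod>i\<in>{1..<q}. of_nat (q - i) - of_nat q :: complex) = (\<Prod>i\<in>{1..q - 1}. - 1 * of_nat i)"
    using assms by (intro prod.cong) (auto simp: of_nat_diff)
  also have "\<dots> = (-1) ^ (q - 1) * fact (q - 1)"
    by (subst prod.distrib) (simp add: fact_prod)
  also have "(\<Prod>i\<in>{1..k}. of_nat (q + i) - of_nat q :: complex) = fact k"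
    by (simp add: fact_prod)
  finally show ?thesis .
qed

section \<open>Derivatives at \<open>\<alpha> = q\<close>, term by term\<close>

context barnes
begin

definition res_den :: "nat \<Rightarrow> complex \<Rightarrow> complex" where
  "res_den q \<alpha> = (\<Prod>j\<in>{1..d} - {q}. of_nat j - \<alpha>)"

text \<open>The derivative at \<open>\<alpha> = q\<close> of
  \<open>dpow m (of_nat d - \<alpha>) x / res_den q \<alpha>\<close>, where
  \<open>k = d - q - m\<close>.\<close>

definition dcoef :: "nat \<Rightarrow> nat \<Rightarrow> complex \<Rightarrow> complex" where
  "dcoef q k x = (-1) ^ (q - 1) / (fact (q - 1) * fact k) * (x ^ k * (harm k - harm (q - 1) - L x))"

lemma zeta_den_res_den: "q \<in> {1..d} \<Longrightarrow> zeta_den \<alpha> = (of_nat q - \<alpha>) * res_den q \<alpha>"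
  unfolding zeta_den_eq res_den_def by (rule prod.remove) auto

lemma res_den_neq_0: "res_den q (of_nat q) \<noteq> 0"
  by (auto simp: res_den_def)

lemma res_den_holomorphic: "res_den q holomorphic_on A"
  unfolding res_den_def[abs_def] by (intro holomorphic_intros)

text \<open>The factors of \<open>falling m (of_nat d - \<alpha>)\<close> are those with
  \<open>j > q + k\<close>, hence avoid \<open>j = q\<close> and can be split off from
  \<open>res_den\<close>.\<close>

lemma res_den_falling:
  assumes "q \<ge> 1" "d = q + k + m"
  shows "res_den q \<alpha> = falling m (of_nat d - \<alpha>) * (\<Prod>j\<in>{1..q + k} - {q}. of_nat j - \<alpha>)"
proof -
  have qk: "q + k + 1 = Suc (d - m)" "m \<le> d" using assms by simp_all
  have "falling m (of_nat d - \<alpha>) = (\<Prod>j\<in>{q + k + 1..d}. of_nat j - \<alpha>)"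
    unfolding falling_def qk(1)
    by (rule prod.reindex_bij_witness[of _ "\<lambda>j. d - j" "\<lambda>i. d - i"])
      (use qk(2) in \<open>auto simp: of_nat_diff\<close>)
  moreover have split: "{1..d} - {q} = {q + k + 1..d} \<union> ({1..q + k} - {q})"
  proof (rule set_eqI)
    fix x show "x \<in> {1..d} - {q} \<longleftrightarrow> x \<in> {q + k + 1..d} \<union> ({1..q + k} - {q})"
      unfolding Diff_iff Un_iff atLeastAtMost_iff singleton_iff using assms by presburger
  qed
  have "res_den q \<alpha> = (\<Prod>j\<in>{q + k + 1..d}. of_nat j - \<alpha>) * (\<Prod>j\<in>{1..q + k} - {q}. of_nat j - \<alpha>)"
    unfolding res_den_def by (subst split, rule prod.union_disjoint) auto
  ultimately show ?thesis by simp
qed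

lemma open_res_den_neq_0: "open {\<alpha>. res_den q \<alpha> \<noteq> 0}"
proof -
  have "continuous_on UNIV (res_den q)"
    by (intro holomorphic_on_imp_continuous_on res_den_holomorphic)
  then show ?thesis by (intro open_Collect_neq) auto
qed

text \<open>The falling factorial cancels against \<open>res_den\<close>, leaving
  \<open>e / \<rho>\<close>. At \<open>q\<close> the exponential is \<open>x ^ k\<close>, and the
  logarithmic derivative of \<open>\<rho>\<close> is minus a difference of harmonic numbers.\<close>

lemma dpow_div_res_den_has_field_derivative:
  assumes x: "x \<in> H" and q: "q \<ge> 1" and dq: "d = q + k + m"
  shows "((\<lambda>\<alpha>. dpow m (of_nat d - \<alpha>) x / res_den q \<alpha>) has_field_derivative dcoef q k x) (at (of_nat q))"
proof -
  define \<rho> where "\<rho> = (\<lambda>\<alpha>. \<Prod>j\<in>{1..q + k} - {q}. complex_of_nat j - \<alpha>)"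
  define c :: complex where "c = (-1) ^ (q - 1) * fact (q - 1) * fact k"
  define h :: complex where "h = harm k - harm (q - 1)"
  have \<rho>q: "\<rho> (of_nat q) = c" unfolding \<rho>_def c_def by (rule prod_punctured[OF q])
  have c0: "c \<noteq> 0" by (simp add: c_def)
  have "(\<rho> has_field_derivative \<rho> (of_nat q) * (\<Sum>j\<in>{1..q + k} - {q}. (-1) / (of_nat j - of_nat q))) (at (of_nat q))"
    unfolding \<rho>_def by (rule has_field_derivative_prod') (auto intro!: derivative_eq_intros)
  also have "(\<Sum>j\<in>{1..q + k} - {q}. (-1) / (of_nat j - of_nat q :: complex)) = - h"
    using sum_inverse_punctured[OF q, of k] by (simp add: h_def sum_negf flip: minus_divide_left)
  finally have \<rho>': "(\<rho> has_field_derivative - (c * h)) (at (of_nat q))" by (simp add: \<rho>q)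
  define e where "e = (\<lambda>\<alpha>. exp ((of_nat d - \<alpha> - of_nat m) * L x))"
  have e': "(e has_field_derivative - (x ^ k * L x)) (at (of_nat q))"
  proof -
    have "exp ((of_nat d - of_nat q - of_nat m) * L x) = x ^ k"
      using exp_L[OF x] by (simp add: dq exp_of_nat_mult)
    then show ?thesis unfolding e_def by (auto intro!: derivative_eq_intros)
  qed
  have eq: "e (of_nat q) = x ^ k"
    using exp_L[OF x] by (simp add: e_def dq exp_of_nat_mult)
  have "((\<lambda>\<alpha>. e \<alpha> / \<rho> \<alpha>) has_field_derivative (- (x ^ k * L x) * c - x ^ k * - (c * h)) / (c * c)) (at (of_nat q))"
    using DERIV_divide[OF e' \<rho>'] c0 unfolding \<rho>q eq by simp
  also have "(- (x ^ k * L x) * c - x ^ k * - (c * h)) / (c * c) = x ^ k * (h - L x) / c"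
    using c0 by (simp add: field_simps)
  also have "\<dots> = dcoef q k x"
  proof -
    have "1 / c = (-1) ^ (q - 1) / (fact (q - 1) * fact k)"
      by (simp add: c_def minus_one_power_iff)
    then show ?thesis by (simp add: dcoef_def h_def mult.commute divide_inverse)
  qed
  finally show ?thesis
  proof (rule has_field_derivative_transform_within_open[OF _ open_res_den_neq_0])
    show "of_nat q \<in> {\<alpha>. res_den q \<alpha> \<noteq> 0}" using res_den_neq_0 by simp
    fix \<alpha> assume "\<alpha> \<in> {\<alpha>. res_den q \<alpha> \<noteq> 0}"
    then show "e \<alpha> / \<rho> \<alpha> = dpow m (of_nat d - \<alpha>) x / res_den q \<alpha>"
      unfolding res_den_falling[OF q dq] by (simp add: dpow_def e_def \<rho>_def)
  qed
qed

text \<open>Pulling the factor \<open>of_nat q - \<alpha>\<close> out of \<open>zeta_den\<close>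
  gives the quotient form required by \<open>finite_part_simple_pole\<close>; the minus sign comes
  from reversing that factor.\<close>

lemma finite_part_barnes_zeta:
  assumes q: "q \<in> {1..d}"
  shows "finite_part (barnes_zeta L d a w) (of_nat q) = deriv (\<lambda>\<alpha>. - zeta_num \<alpha> / res_den q \<alpha>) (of_nat q)"
proof (rule finite_part_simple_pole)
  have an: "f analytic_on A" if "f holomorphic_on UNIV" for f :: "complex \<Rightarrow> complex" and A
    by (rule analytic_on_subset[OF _ subset_UNIV]) (simp add: analytic_on_open that)
  note an = an[OF zeta_num_holomorphic] an[OF res_den_holomorphic] an[OF zeta_den_holomorphic]
  show "(\<lambda>\<alpha>. - zeta_num \<alpha> / res_den q \<alpha>) analytic_on {of_nat q}"
    using res_den_neq_0 by (intro analytic_intros an) auto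
  have "(\<lambda>\<alpha>. zeta_num \<alpha> / zeta_den \<alpha>) meromorphic_on {of_nat q}"
    by (intro meromorphic_intros analytic_on_imp_meromorphic_on an)
  then have "eventually (\<lambda>\<alpha>. remove_sings (\<lambda>\<alpha>. zeta_num \<alpha> / zeta_den \<alpha>) \<alpha> = zeta_num \<alpha> / zeta_den \<alpha>) (at (of_nat q))"
    by (intro eventually_remove_sings_eq_at meromorphic_on_isolated_singularity)
  moreover have "zeta_num \<alpha> / zeta_den \<alpha> = - zeta_num \<alpha> / res_den q \<alpha> / (\<alpha> - of_nat q)" for \<alpha>
  proof -
    have "zeta_den \<alpha> = - (res_den q \<alpha> * (\<alpha> - of_nat q))"
      unfolding zeta_den_res_den[OF q] by (simp add: algebra_simps)
    then show ?thesis by simp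
  qed
  ultimately show "eventually (\<lambda>\<alpha>. barnes_zeta L d a w \<alpha> = - zeta_num \<alpha> / res_den q \<alpha> / (\<alpha> - of_nat q)) (at (of_nat q))"
    by (simp add: barnes_zeta_eq)
qed

text \<open>The contribution of the lattice point \<open>x\<close> to the finite part: the
  derivative at \<open>\<alpha> = q\<close> of
  \<open>- err M \<alpha> x / res_den q \<alpha>\<close> for \<open>M = d - q + 1\<close>.\<close>

definition fp_term :: "nat \<Rightarrow> complex \<Rightarrow> complex" where
  "fp_term q x = 1 / x ^ q + (\<Sum>m<d - q + 1. todd m * G_op d (\<lambda>y. dcoef q (d - q - m) (x + y)) w)"

lemma err_div_res_den_has_field_derivative:
  assumes x: "x \<in> H" and q: "q \<in> {1..d}"
  shows "((\<lambda>\<alpha>. - err (d - q + 1) \<alpha> x / res_den q \<alpha>) has_field_derivative fp_term q x) (at (of_nat q))"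
proof -
  let ?M = "d - q + 1"
  \<comment> \<open>The same quotient with \<open>res_den\<close> cancelled from the leading term.
    The factor \<open>\<alpha> - of_nat q\<close> vanishes at \<open>q\<close>, so the derivative of
    that term is just \<open>1 / x ^ q\<close>.\<close>
  define f where "f = (\<lambda>\<alpha>. (\<alpha> - of_nat q) * exp (- \<alpha> * L x) +
    (\<Sum>m<?M. todd m * G_op d (\<lambda>y. dpow m (of_nat d - \<alpha>) (x + y) / res_den q \<alpha>) w))"
  have "exp (of_nat q * L x) = x ^ q" using exp_L[OF x] by (simp add: exp_of_nat_mult)
  then have e: "exp (- of_nat q * L x) = 1 / x ^ q" by (simp add: exp_minus inverse_eq_divide)
  have f1: "((\<lambda>\<alpha>. (\<alpha> - of_nat q) * exp (- \<alpha> * L x)) has_field_derivative 1 / x ^ q) (at (of_nat q))"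
    by (rule derivative_eq_intros refl)+ (use e in simp)
  have f2: "((\<lambda>\<alpha>. \<Sum>m<?M. todd m * G_op d (\<lambda>y. dpow m (of_nat d - \<alpha>) (x + y) / res_den q \<alpha>) w)
    has_field_derivative (\<Sum>m<?M. todd m * G_op d (\<lambda>y. dcoef q (d - q - m) (x + y)) w)) (at (of_nat q))"
    unfolding G_op_def
    by (intro DERIV_sum DERIV_cmult dpow_div_res_den_has_field_derivative add_wsum_H x) (use q in auto)
  have "(f has_field_derivative fp_term q x) (at (of_nat q))"
    unfolding f_def fp_term_def by (rule DERIV_add[OF f1 f2])
  then show ?thesis
  proof (rule has_field_derivative_transform_within_open[OF _ open_res_den_neq_0])
    show "of_nat q \<in> {\<alpha>. res_den q \<alpha> \<noteq> 0}" using res_den_neq_0 by simp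
    fix \<alpha> assume "\<alpha> \<in> {\<alpha>. res_den q \<alpha> \<noteq> 0}"
    then have r: "res_den q \<alpha> \<noteq> 0" by simp
    define X where "X = (\<Sum>m<?M. todd m * G_op d (\<lambda>y. dpow m (of_nat d - \<alpha>) (x + y)) w)"
    have "G_op d (\<lambda>y. dpow m (of_nat d - \<alpha>) (x + y) / res_den q \<alpha>) w =
        G_op d (\<lambda>y. dpow m (of_nat d - \<alpha>) (x + y)) w / res_den q \<alpha>" for m
      using G_op_cmult[of d "1 / res_den q \<alpha>" "\<lambda>y. dpow m (of_nat d - \<alpha>) (x + y)" w] by simp
    then have "f \<alpha> = (\<alpha> - of_nat q) * exp (- \<alpha> * L x) + X / res_den q \<alpha>"
      by (simp only: f_def X_def sum_divide_distrib times_divide_eq_right)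
    moreover have "dpow d (of_nat d - \<alpha>) x / res_den q \<alpha> = (of_nat q - \<alpha>) * exp (- \<alpha> * L x)"
      using r by (simp add: dpow_def zeta_den_res_den[OF q] flip: zeta_den_def)
    moreover have "- err ?M \<alpha> x / res_den q \<alpha> = X / res_den q \<alpha> - dpow d (of_nat d - \<alpha>) x / res_den q \<alpha>"
      by (simp only: err_def X_def minus_diff_eq diff_divide_distrib)
    ultimately show "f \<alpha> = - err ?M \<alpha> x / res_den q \<alpha>"
      by (simp only:) (simp add: algebra_simps)
  qed
qed

lemma finite_part_formula:
  assumes q: "q \<in> {1..d}"
  shows "(\<lambda>n. fp_term q (node n)) summable_on nat_vecs d"
    "finite_part (barnes_zeta L d a w) (of_nat q) =
       (-1) ^ (d + 1) * (\<Sum>m<d - q + 1. todd m * dcoef q (d - q - m) a) + (\<Sum>\<^sub>\<infinity>n\<in>nat_vecs d. fp_term q (node n))"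
proof -
  let ?M = "d - q + 1" and ?q = "of_nat q :: complex"
  define r where "r = res_den q ?q"
  define r' where "r' = deriv (res_den q) ?q"
  define A where "A = (\<lambda>\<alpha>. \<Sum>\<^sub>\<infinity>n\<in>nat_vecs d. err ?M \<alpha> (node n))"
  have r0: "r \<noteq> 0" by (simp add: r_def res_den_neq_0)
  have r': "(res_den q has_field_derivative r') (at ?q)"
    unfolding r'_def by (rule holomorphic_derivI[OF res_den_holomorphic open_UNIV UNIV_I])
  \<comment> \<open>Here \<open>d - M = q - 1\<close>, so \<open>M = d - q + 1\<close> is the least
    truncation order that reaches \<open>q\<close>.\<close>
  have Re: "Re ?q > real d - real ?M" using q by (simp add: of_nat_diff)
  obtain D where D: "(A has_field_derivative D) (at ?q)"
    and DS: "((\<lambda>n. deriv (\<lambda>\<alpha>. err ?M \<alpha> (node n)) ?q) has_sum D) (nat_vecs d)"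
    unfolding A_def by (rule err_infsum_has_field_derivative[OF Re])
  have AS: "((\<lambda>n. err ?M ?q (node n)) has_sum A ?q) (nat_vecs d)"
    unfolding A_def by (intro has_sum_infsum err_summable Re)
  define T where "T = - ((D * r - A ?q * r') / (r * r))"
  have quot: "((\<lambda>\<alpha>. - g \<alpha> / res_den q \<alpha>) has_field_derivative - ((g' * r - g ?q * r') / (r * r))) (at ?q)"
    if "(g has_field_derivative g') (at ?q)" for g g'
    using DERIV_minus[OF DERIV_divide[OF that r' res_den_neq_0]] by (simp add: r_def)
  \<comment> \<open>Uniqueness of the derivative compares the explicit formula with the quotient
    rule. This writes \<open>fp_term\<close> as a fixed linear combination of two summable families,
    which also yields its summability.\<close>
  have term_eq: "fp_term q (node n) = (- r / (r * r)) * deriv (\<lambda>\<alpha>. err ?M \<alpha> (node n)) ?q + (r' / (r * r)) * err ?M ?q (node n)" for n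
  proof -
    have "((\<lambda>\<alpha>. err ?M \<alpha> (node n)) has_field_derivative deriv (\<lambda>\<alpha>. err ?M \<alpha> (node n)) ?q) (at ?q)"
      by (rule holomorphic_derivI[OF err_holomorphic open_UNIV UNIV_I])
    from DERIV_unique[OF err_div_res_den_has_field_derivative[OF node_H q] quot[OF this]]
    show ?thesis by (simp add: diff_divide_distrib mult_ac)
  qed
  have "((\<lambda>n. fp_term q (node n)) has_sum ((- r / (r * r)) * D + (r' / (r * r)) * A ?q)) (nat_vecs d)"
    unfolding term_eq by (intro has_sum_add has_sum_cmult_right DS AS)
  also have "(- r / (r * r)) * D + (r' / (r * r)) * A ?q = T"
    by (simp add: T_def diff_divide_distrib mult_ac)
  finally have TS: "((\<lambda>n. fp_term q (node n)) has_sum T) (nat_vecs d)" .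
  then show "(\<lambda>n. fp_term q (node n)) summable_on nat_vecs d" by (rule has_sum_imp_summable)
  have 1: "((\<lambda>\<alpha>. - A \<alpha> / res_den q \<alpha>) has_field_derivative T) (at ?q)"
    unfolding T_def by (rule quot[OF D])
  have 2: "((\<lambda>\<alpha>. (-1) ^ (d + 1) * (\<Sum>m<?M. todd m * (dpow m (of_nat d - \<alpha>) a / res_den q \<alpha>)))
    has_field_derivative (-1) ^ (d + 1) * (\<Sum>m<?M. todd m * dcoef q (d - q - m) a)) (at ?q)"
    by (intro DERIV_cmult DERIV_sum dpow_div_res_den_has_field_derivative a) (use q in auto)
  have "((\<lambda>\<alpha>. - zeta_num \<alpha> / res_den q \<alpha>) has_field_derivative
      T + (-1) ^ (d + 1) * (\<Sum>m<?M. todd m * dcoef q (d - q - m) a)) (at ?q)"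
  proof (rule has_field_derivative_transform_within_open[OF DERIV_add[OF 1 2] open_halfspace_Re_gt[of "real d - real ?M"]])
    fix \<alpha> assume "\<alpha> \<in> {z. real d - real ?M < Re z}"
    then have "zeta_num \<alpha> = A \<alpha> + (-1) ^ d * (\<Sum>m<?M. todd m * dpow m (of_nat d - \<alpha>) a)"
      by (simp add: zeta_num_eq[of ?M] num_def A_def)
    then show "- A \<alpha> / res_den q \<alpha> + (-1) ^ (d + 1) * (\<Sum>m<?M. todd m * (dpow m (of_nat d - \<alpha>) a / res_den q \<alpha>)) =
        - zeta_num \<alpha> / res_den q \<alpha>"
      by (simp add: sum_divide_distrib[symmetric] diff_divide_distrib)
  qed (use Re in simp)
  then have "finite_part (barnes_zeta L d a w) ?q = T + (-1) ^ (d + 1) * (\<Sum>m<?M. todd m * dcoef q (d - q - m) a)"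
    unfolding finite_part_barnes_zeta[OF q] by (rule DERIV_imp_deriv)
  with infsumI[OF TS] show "finite_part (barnes_zeta L d a w) ?q =
       (-1) ^ (d + 1) * (\<Sum>m<?M. todd m * dcoef q (d - q - m) a) + (\<Sum>\<^sub>\<infinity>n\<in>nat_vecs d. fp_term q (node n))"
    by simp
qed

text \<open>The part of \<open>dcoef\<close> without the logarithm is a multiple of
  \<open>(x + y) ^ k\<close> with \<open>k < d\<close>, so the difference operator removes it
  together with the harmonic numbers.\<close>

lemma G_op_dcoef:
  assumes "k < d" "q \<ge> 1"
  shows "G_op d (\<lambda>y. dcoef q k (x + y)) w =
    (-1) ^ q / (fact (q - 1) * fact k) * G_op d (\<lambda>y. (x + y) ^ k * L (x + y)) w"
proof -
  define c :: complex where "c = (-1) ^ q / (fact (q - 1) * fact k)"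
  have sgn: "(-1) ^ (q - 1) / (fact (q - 1) * fact k) = - c"
    using assms(2) by (cases q) (auto simp: c_def)
  have "(\<lambda>y. dcoef q k (x + y)) = (\<lambda>y. (- c * (harm k - harm (q - 1))) * (x + y) ^ k + c * ((x + y) ^ k * L (x + y)))"
    unfolding dcoef_def sgn by (simp add: fun_eq_iff algebra_simps)
  then show ?thesis
    by (simp only: G_op_add G_op_cmult G_op_shift_power_eq_0[OF assms(1)] c_def[symmetric]) simp
qed

end

section \<open>Translation to Bernoullian functions and matching of signs\<close>

theorem mainTheorem1:
  fixes \<theta> :: real and L :: "complex \<Rightarrow> complex"
    and d q :: nat and a :: complex and w :: "nat \<Rightarrow> complex"
  assumes "log_branch_on (half_plane \<theta>) L"
    and "d \<ge> 1"
    and "a \<in> half_plane \<theta>"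
    and "\<And>i. i \<in> {1..d} \<Longrightarrow> w i \<in> half_plane \<theta>"
    and "q \<in> {1..d}"
  shows
    "let S = (\<lambda>m. poly ((pderiv ^^ d) (bernoullian d w m)) 0);
         T = (\<lambda>n. 1 / (a + ndot d n w) ^ q
               + (-1) ^ q / fact (q - 1) *
                 (\<Sum>m=0..d - q. S m / (fact m * fact (d - q - m)) *
                    G_op d (\<lambda>x. (a + ndot d n w + x) ^ (d - q - m)
                                 * L (a + ndot d n w + x)) w))
     in (\<lambda>n. norm (T n)) summable_on nat_vecs d \<and>
        finite_part (barnes_zeta L d a w) (of_nat q) =
          (-1) ^ (d - q + 1) / fact (q - 1) *
            (\<Sum>m=0..d - q. S m * a ^ (d - q - m) / (fact m * fact (d - q - m)) *
               (L a - harm (d - q - m) + harm (q - 1)))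
          + (\<Sum>\<^sub>\<infinity>n\<in>nat_vecs d. T n)"
proof -
  interpret barnes \<theta> L d a w
    by (rule barnes.intro) (fact assms)+
  define S where "S = (\<lambda>m. poly ((pderiv ^^ d) (bernoullian d w m)) 0)"
  define T where "T = (\<lambda>n. 1 / (a + ndot d n w) ^ q
               + (-1) ^ q / fact (q - 1) *
                 (\<Sum>m=0..d - q. S m / (fact m * fact (d - q - m)) *
                    G_op d (\<lambda>x. (a + ndot d n w + x) ^ (d - q - m)
                                 * L (a + ndot d n w + x)) w))"
  note q = assms(5)
  have S: "S m = fact m * todd m" for m
    unfolding S_def using assms(2) w_neq_0 by (rule bernoullian_higher_deriv)
  have ivl: "{..<d - q + 1} = {0..d - q}" by auto
  have T: "fp_term q (node n) = T n" for n
  proof -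
    have "(\<Sum>m\<in>{0..d - q}. todd m * G_op d (\<lambda>y. dcoef q (d - q - m) (node n + y)) w) =
        (-1) ^ q / fact (q - 1) * (\<Sum>m=0..d - q. S m / (fact m * fact (d - q - m)) *
          G_op d (\<lambda>x. (node n + x) ^ (d - q - m) * L (node n + x)) w)"
      unfolding sum_distrib_left
    proof (rule sum.cong[OF refl])
      fix m
      have "d - q - m < d" "q \<ge> 1" using q by auto
      then show "todd m * G_op d (\<lambda>y. dcoef q (d - q - m) (node n + y)) w =
        (-1) ^ q / fact (q - 1) * (S m / (fact m * fact (d - q - m)) *
          G_op d (\<lambda>x. (node n + x) ^ (d - q - m) * L (node n + x)) w)"
        by (simp add: G_op_dcoef S)
    qed
    then show ?thesis by (simp only: fp_term_def ivl T_def)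
  qed
  \<comment> \<open>The exponents \<open>d + q\<close> and \<open>d - q\<close> have equal parity;
    the leftover minus sign reverses \<open>harm k - harm (q - 1) - L a\<close> inside
    \<open>dcoef\<close>.\<close>
  have sgn: "(-1 :: complex) ^ (d + 1) * ((-1) ^ (q - 1) / F) = - ((-1) ^ (d - q + 1) / F)" for F
  proof -
    obtain p where "q = Suc p" using q by (cases q) auto
    moreover obtain e where "d = q + e" using q by (metis atLeastAtMost_iff le_iff_add)
    moreover have "(-1 :: complex) ^ p * (-1) ^ p = 1" by (simp flip: power_mult_distrib)
    then have "(-1) ^ p * (-1) ^ e * ((-1) ^ p / F) = (-1) ^ e / F"
      by (metis mult.assoc mult.commute mult.right_neutral times_divide_eq_right)
    ultimately show ?thesis by (simp add: power_add)
  qed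
  have "(-1) ^ (d + 1) * (\<Sum>m<d - q + 1. todd m * dcoef q (d - q - m) a) =
    (-1) ^ (d - q + 1) / fact (q - 1) *
            (\<Sum>m=0..d - q. S m * a ^ (d - q - m) / (fact m * fact (d - q - m)) *
               (L a - harm (d - q - m) + harm (q - 1)))"
    unfolding ivl sum_distrib_left
  proof (rule sum.cong[OF refl])
    fix m
    let ?k = "d - q - m"
    have "(-1) ^ (d + 1) * (todd m * dcoef q ?k a) =
      ((-1) ^ (d + 1) * ((-1) ^ (q - 1) / (fact (q - 1) * fact ?k))) * (todd m * (a ^ ?k * (harm ?k - harm (q - 1) - L a)))"
      by (simp add: dcoef_def mult_ac)
    also have "\<dots> = (-1) ^ (d - q + 1) / fact (q - 1) * (S m * a ^ ?k / (fact m * fact ?k) * (L a - harm ?k + harm (q - 1)))"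
      unfolding sgn S by (simp add: field_simps)
    finally show "(-1) ^ (d + 1) * (todd m * dcoef q ?k a) = \<dots>" .
  qed
  with finite_part_formula[OF q] have
    "T summable_on nat_vecs d"
    "finite_part (barnes_zeta L d a w) (of_nat q) =
          (-1) ^ (d - q + 1) / fact (q - 1) *
            (\<Sum>m=0..d - q. S m * a ^ (d - q - m) / (fact m * fact (d - q - m)) *
               (L a - harm (d - q - m) + harm (q - 1)))
          + (\<Sum>\<^sub>\<infinity>n\<in>nat_vecs d. T n)"
    by (simp_all only: T)
  \<comment> \<open>For complex families unordered summability is equivalent to absolute
    summability.\<close>
  then show ?thesis
    unfolding summable_on_iff_abs_summable_on_complex T_def S_def Let_def by (rule conjI)
qed

end
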